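(* Let $(\mathcal U,\rho)$ be a complete metric space and let $f\in B(\mathbb R,\mathcal U)$. Then for any $\epsilon>0$ there exist a sequence $\{T_j\}_{j\in\mathbb N}\in\mathfrak M^{(B)}(\mathrm{Mod}\,f)$ and points $x_j\in\mathcal U$, $j\in\mathbb N$, such that $\rho(f(t),x_j)<\epsilon$ for all $t\in T_j$, $j\in\mathbb N$.
   Context: Let $(\mathcal U,\rho)$ be a complete metric space with a fixed point $x_0\in\mathcal U$ (the definitions do not depend on its choice). A function $f:\mathbb R\to\mathcal U$ is elementary if there are points $x_j\in\mathcal U$ and disjoint Lebesgue measurable sets $T_j\subseteq\mathbb R$, $j\in\mathbb N$, with $\mathrm{meas}(\mathbb R\setminus\bigcup_jT_j)=0$ and $f(t)=x_j$ for $t\in T_j$. A function $f$ is measurable if for every $\epsilon>0$ there is an elementary $f_\epsilon$ with $\operatorname{ess\,sup}_{t}\rho(f(t),f_\epsilon(t))<\epsilon$. $M(\mathbb R,\mathcal U)$ is the set of measurable functions, with functions equal a.e. identified. For $p\ge1$: $M_p(\mathbb R,\mathcal U)$ is the set of $f\in M(\mathbb R,\mathcal U)$ with $\sup_{\xi\in\mathbb R}\int_\xi^{\xi+1}\rho^p(f(t),x_0)\,dt<\infty$, and $D^{(S)}_p(f,g)=\big(\sup_\xi\int_\xi^{\xi+1}\rho^p(f(t),g(t))\,dt\big)^{1/p}$. A set $T\subseteq\mathbb R$ is relatively dense if there is $a>0$ with $[\xi,\xi+a]\cap T\ne\emptyset$ for all $\xi\in\mathbb R$. $S_p(\mathbb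 R,\mathcal U)$ is the set of $f\in M_p(\mathbb R,\mathcal U)$ such that for every $\epsilon>0$ the set of $\tau\in\mathbb R$ with $D^{(S)}_p(f(\cdot),f(\cdot+\tau))<\epsilon$ is relatively dense. $\mathcal M_p(\mathbb R,\mathcal U)$ is the set of $f\in M(\mathbb R,\mathcal U)$ with $\rho(f(\cdot),x_0)\in L^p_{\rm loc}(\mathbb R,\mathbb R)$ and $\limsup_{b\to+\infty}\frac1{2b}\int_{-b}^b\rho^p(f(t),x_0)\,dt<\infty$, and $D^{(B)}_p(f,g)=\big(\limsup_{b\to+\infty}\frac1{2b}\int_{-b}^b\rho^p(f(t),g(t))\,dt\big)^{1/p}$. $B_p(\mathbb R,\mathcal U)$ (Besicovitch almost periodic functions of order $p$) is the set of $f\in\mathcal M_p(\mathbb R,\mathcal U)$ such that for every $\epsilon>0$ there is $f_\epsilon\in S_p(\mathbb R,\mathcal U)$ with $D^{(B)}_p(f,f_\epsilon)<\epsilon$. Let $\rho'(x,y)=\min\{1,\rho(x,y)\}$ and $D^{(B)}(f,g)=\limsup_{b\to+\infty}\frac1{2b}\int_{-b}^b\rho'(f(t),g(t))\,dt$ for $f,g\in M(\mathbb R,\mathcal U)$. $B(\mathbb R,\mathcal U)$ (Besicovitch almost periodic functions) is defined as $B_1(\mathbb R,(\mathcal U,\rho'))$; $B_p(\mathbb R,\mathcal U)\subseteq B(\mathbb R,\mathcal U)$. For $f\in B(\mathbb R,\mathcal U)$ a sequence $\tau_j\in\mathbb R$ is $f$-returning if $D^{(B)}(f(\cdot),f(\cdot+\tau_j))\to0$,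 and $\mathrm{Mod}\,f$ is the set (additive subgroup of $\mathbb R$) of all $\lambda\in\mathbb R$ such that $e^{i\lambda\tau_j}\to1$ for every $f$-returning sequence $\tau_j$. For measurable $T\subseteq\mathbb R$, $\widetilde\kappa(T)=\limsup_{b\to+\infty}\frac1{2b}\mathrm{meas}([-b,b]\setminus T)$. $B(\mathbb R)$ is the collection of measurable sets $T\subseteq\mathbb R$ whose characteristic function $\chi_T$ lies in $B_1(\mathbb R,\mathbb R)$, and $\mathrm{Mod}\,T=\mathrm{Mod}\,\chi_T$. For a module (additive subgroup) $\Lambda\subseteq\mathbb R$, $\mathfrak M^{(B)}(\Lambda)$ is the set of sequences $\{T_j\}_{j\in\mathbb N}$ of disjoint sets $T_j\in B(\mathbb R)$ such that $\mathrm{Mod}\,T_j\subseteq\Lambda$ for all $j$, $\mathrm{meas}(\mathbb R\setminus\bigcup_jT_j)=0$ and $\widetilde\kappa(\bigcup_{j\le n}T_j)\to0$ as $n\to+\infty$ (finite sequences are included by appending empty sets). *)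

theory Defs
  imports "HOL-Probability.Essential_Supremum"
begin

text \<open>
  The distance function \<open>d\<close> is an explicit parameter because the same point set is used with two
  metrics, \<open>dist\<close> and its truncation \<open>trunc_metric dist\<close>. The base point \<open>x0\<close> is a
  parameter as well. Functions are representatives: classes modulo a.e. equality are not formed, and the
  function spaces and seminorms below are invariant under changes on null sets. ``Measurable'' subsets of the line are
  elements of \<open>sets lebesgue\<close>. Seminorms and densities are taken in \<open>ennreal\<close>, so that
  an infinite supremum, upper limit or integral is not collapsed to a junk real value.
\<close>

definition trunc_metric :: "('a \<Rightarrow> 'a \<Rightarrow> real) \<Rightarrow> 'a \<Rightarrow> 'a \<Rightarrow> real" where
  "trunc_metric d x y = min 1 (d x y)"

definition elementary_fun :: "(real \<Rightarrow> 'a) \<Rightarrow> bool" where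
  "elementary_fun f \<longleftrightarrow>
     (\<exists>(x :: nat \<Rightarrow> 'a) (T :: nat \<Rightarrow> real set).
        (\<forall>j. T j \<in> sets lebesgue) \<and> disjoint_family T \<and>
        emeasure lebesgue (UNIV - (\<Union>j. T j)) = 0 \<and>
        (\<forall>j. \<forall>t\<in>T j. f t = x j))"

(* The library's esssup of a function that is not Borel measurable is top. This is harmless here: if f is
   an a.e. uniform limit of elementary functions, the distance to any elementary function is Lebesgue
   measurable. *)
definition measurable_funs :: "('a \<Rightarrow> 'a \<Rightarrow> real) \<Rightarrow> (real \<Rightarrow> 'a) set" where
  "measurable_funs d =
     {f. \<forall>\<epsilon>>0. \<exists>g. elementary_fun g \<and>
           esssup lebesgue (\<lambda>t. ennreal (d (f t) (g t))) < ennreal \<epsilon>}"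

definition ennreal_root :: "real \<Rightarrow> ennreal \<Rightarrow> ennreal" where
  "ennreal_root p x = (if x = top then top else ennreal (enn2real x powr (1 / p)))"

definition stepanov_bounded :: "('a \<Rightarrow> 'a \<Rightarrow> real) \<Rightarrow> 'a \<Rightarrow> real \<Rightarrow> (real \<Rightarrow> 'a) set" where
  "stepanov_bounded d x0 p =
     {f \<in> measurable_funs d.
        (SUP \<xi>::real. \<integral>\<^sup>+ t\<in>{\<xi>..\<xi> + 1}. ennreal (d (f t) x0 powr p) \<partial>lebesgue) < top}"

definition stepanov_dist ::
  "('a \<Rightarrow> 'a \<Rightarrow> real) \<Rightarrow> real \<Rightarrow> (real \<Rightarrow> 'a) \<Rightarrow> (real \<Rightarrow> 'a) \<Rightarrow> ennreal" where
  "stepanov_dist d p f g =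
     ennreal_root p
       (SUP \<xi>::real. \<integral>\<^sup>+ t\<in>{\<xi>..\<xi> + 1}. ennreal (d (f t) (g t) powr p) \<partial>lebesgue)"

definition relatively_dense :: "real set \<Rightarrow> bool" where
  "relatively_dense T \<longleftrightarrow> (\<exists>a>0. \<forall>\<xi>. {\<xi>..\<xi> + a} \<inter> T \<noteq> {})"

definition stepanov_ap :: "('a \<Rightarrow> 'a \<Rightarrow> real) \<Rightarrow> 'a \<Rightarrow> real \<Rightarrow> (real \<Rightarrow> 'a) set" where
  "stepanov_ap d x0 p =
     {f \<in> stepanov_bounded d x0 p.
        \<forall>\<epsilon>>0. relatively_dense {\<tau>. stepanov_dist d p f (\<lambda>t. f (t + \<tau>)) < ennreal \<epsilon>}}"

definition upper_mean :: "(real \<Rightarrow> real) \<Rightarrow> ennreal" where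
  "upper_mean h =
     Limsup at_top (\<lambda>b::real. (\<integral>\<^sup>+ t\<in>{- b..b}. ennreal (h t) \<partial>lebesgue) / ennreal (2 * b))"

definition besicovitch_bounded :: "('a \<Rightarrow> 'a \<Rightarrow> real) \<Rightarrow> 'a \<Rightarrow> real \<Rightarrow> (real \<Rightarrow> 'a) set" where
  "besicovitch_bounded d x0 p =
     {f \<in> measurable_funs d.
        (\<forall>a b. set_integrable lebesgue {a..b} (\<lambda>t. d (f t) x0 powr p)) \<and>
        upper_mean (\<lambda>t. d (f t) x0 powr p) < top}"

definition besicovitch_dist_p ::
  "('a \<Rightarrow> 'a \<Rightarrow> real) \<Rightarrow> real \<Rightarrow> (real \<Rightarrow> 'a) \<Rightarrow> (real \<Rightarrow> 'a) \<Rightarrow> ennreal" where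
  "besicovitch_dist_p d p f g = ennreal_root p (upper_mean (\<lambda>t. d (f t) (g t) powr p))"

definition besicovitch_ap_p :: "('a \<Rightarrow> 'a \<Rightarrow> real) \<Rightarrow> 'a \<Rightarrow> real \<Rightarrow> (real \<Rightarrow> 'a) set" where
  "besicovitch_ap_p d x0 p =
     {f \<in> besicovitch_bounded d x0 p.
        \<forall>\<epsilon>>0. \<exists>g \<in> stepanov_ap d x0 p. besicovitch_dist_p d p f g < ennreal \<epsilon>}"

definition besicovitch_dist ::
  "('a \<Rightarrow> 'a \<Rightarrow> real) \<Rightarrow> (real \<Rightarrow> 'a) \<Rightarrow> (real \<Rightarrow> 'a) \<Rightarrow> ennreal" where
  "besicovitch_dist d f g = upper_mean (\<lambda>t. trunc_metric d (f t) (g t))"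

definition besicovitch_ap :: "('a \<Rightarrow> 'a \<Rightarrow> real) \<Rightarrow> 'a \<Rightarrow> (real \<Rightarrow> 'a) set" where
  "besicovitch_ap d x0 = besicovitch_ap_p (trunc_metric d) x0 1"

definition returning_seq ::
  "('a \<Rightarrow> 'a \<Rightarrow> real) \<Rightarrow> (real \<Rightarrow> 'a) \<Rightarrow> (nat \<Rightarrow> real) \<Rightarrow> bool" where
  "returning_seq d f \<tau> \<longleftrightarrow> (\<lambda>j. besicovitch_dist d f (\<lambda>t. f (t + \<tau> j))) \<longlonglongrightarrow> 0"

definition Mod_fun :: "('a \<Rightarrow> 'a \<Rightarrow> real) \<Rightarrow> (real \<Rightarrow> 'a) \<Rightarrow> real set" where
  "Mod_fun d f =
     {\<mu>. \<forall>\<tau>. returning_seq d f \<tau> \<longrightarrow> (\<lambda>j. exp (\<i> * complex_of_real (\<mu> * \<tau> j))) \<longlonglongrightarrow> 1}"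

definition upper_codensity :: "real set \<Rightarrow> ennreal" where
  "upper_codensity T =
     Limsup at_top (\<lambda>b::real. emeasure lebesgue ({- b..b} - T) / ennreal (2 * b))"

definition besicovitch_sets :: "real set set" where
  "besicovitch_sets =
     {T \<in> sets lebesgue. (indicator T :: real \<Rightarrow> real) \<in> besicovitch_ap_p dist 0 1}"

definition Mod_set :: "real set \<Rightarrow> real set" where
  "Mod_set T = Mod_fun dist (indicator T :: real \<Rightarrow> real)"

definition besicovitch_partitions :: "real set \<Rightarrow> (nat \<Rightarrow> real set) set" where
  "besicovitch_partitions \<Lambda> =
     {T. disjoint_family T \<and>
         (\<forall>j. T j \<in> besicovitch_sets \<and> Mod_set (T j) \<subseteq> \<Lambda>) \<and>
         emeasure lebesgue (UNIV - (\<Union>j. T j)) = 0 \<and>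
         (\<lambda>n. upper_codensity (\<Union>j\<le>n. T j)) \<longlonglongrightarrow> 0}"

end

theory Submission
  imports Defs
begin

text \<open>
  Cover almost all of the range of \<open>f\<close> by balls \<open>{u. dist u (x j) < r j}\<close> with
  \<open>\<epsilon> / 2 < r j < \<epsilon>\<close> (for \<open>\<epsilon> \<le> 1\<close>) and make their preimages disjoint. For all but countably many radii
  the preimage of a thin shell around the sphere of radius \<open>r j\<close> has small upper density, so that the
  indicator of the preimage of the ball is approximated in upper mean by Lipschitz functions of \<open>f\<close>.
  This makes the preimages Besicovitch almost periodic, and every \<open>f\<close>-returning sequence returning for
  them, whence the inclusion of the modules.

  Both the choice of the radii and the decay of the codensities rest on one estimate: for each
  \<open>\<eta>\<close> there are a Stepanov almost periodic \<open>g\<close> and an \<open>n\<close> such that the upper mean of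
  \<open>\<Psi> \<circ> f\<close> is at most \<open>\<eta>\<close> plus \<open>1/n\<close> times the integral of \<open>\<Psi> \<circ> g\<close> over
  \<open>[0, 2n]\<close>, simultaneously for all 1-Lipschitz \<open>\<Psi>\<close> with values in \<open>[0, 1]\<close>. It holds because
  every window of length \<open>n\<close> can be translated into \<open>[0, 2n]\<close> by an almost period of \<open>g\<close>.
\<close>

section \<open>Measurability\<close>

lemma interval_sets_lebesgue [measurable]:
  "{a..b::real} \<in> sets lebesgue" "{a..<b::real} \<in> sets lebesgue"
  by auto

text \<open>The preimages of a Borel set under \<open>f\<close> and \<open>g\<close> differ only by
  a null set, and the Lebesgue sigma-algebra is complete.\<close>

lemma borel_measurable_lebesgue_AE_cong:
  fixes f g :: "real \<Rightarrow> 'a::topological_space"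
  assumes f: "f \<in> borel_measurable lebesgue" and eq: "AE t in lebesgue. f t = g t"
  shows "g \<in> borel_measurable lebesgue"
proof (rule measurableI)
  fix A :: "'a set"
  assume A: "A \<in> sets borel"
  show "g -` A \<inter> space lebesgue \<in> sets lebesgue"
  proof (rule completion.in_sets_AE)
    show "f -` A \<inter> space lebesgue \<in> sets lebesgue"
      using f A by (rule measurable_sets)
    show "AE t in lebesgue. (t \<in> f -` A \<inter> space lebesgue) = (t \<in> g -` A \<inter> space lebesgue)"
      using eq by eventually_elim auto
  qed auto
qed auto

text \<open>Up to a null set, the preimage of \<open>A\<close> is the union of those
  \<open>T j\<close> with \<open>x j \<in> A\<close>.\<close>

lemma elementary_fun_borel_measurable:
  fixes f :: "real \<Rightarrow> 'a::topological_space"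
  assumes "elementary_fun f"
  shows "f \<in> borel_measurable lebesgue"
proof (rule measurableI)
  obtain x :: "nat \<Rightarrow> 'a" and T where T: "\<And>j. T j \<in> sets lebesgue"
      "emeasure lebesgue (UNIV - (\<Union>j. T j)) = 0" "\<And>j t. t \<in> T j \<Longrightarrow> f t = x j"
    using assms unfolding elementary_fun_def by metis
  fix A :: "'a set"
  assume "A \<in> sets borel"
  have "UNIV - (\<Union>j. T j) \<in> null_sets lebesgue"
    using T by (auto simp: null_sets_def intro!: sets.compl_sets[where M = lebesgue, simplified])
  then have ae: "AE t in lebesgue. t \<in> (\<Union>j. T j)"
    by (auto dest: AE_not_in)
  show "f -` A \<inter> space lebesgue \<in> sets lebesgue"
  proof (rule completion.in_sets_AE)
    show "(\<Union>j\<in>{j. x j \<in> A}. T j) \<in> sets lebesgue"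
      using T by auto
    show "AE t in lebesgue. (t \<in> (\<Union>j\<in>{j. x j \<in> A}. T j)) = (t \<in> f -` A \<inter> space lebesgue)"
      using ae by eventually_elim (fastforce simp: T(3) dest: T(3))
  qed auto
qed auto

lemma elementary_fun_AE_countable:
  assumes "elementary_fun f"
  obtains C where "countable C" "AE t in lebesgue. f t \<in> C"
proof -
  obtain x :: "nat \<Rightarrow> 'a" and T where T: "\<And>j. T j \<in> sets lebesgue"
      "emeasure lebesgue (UNIV - (\<Union>j. T j)) = 0" "\<And>j t. t \<in> T j \<Longrightarrow> f t = x j"
    using assms unfolding elementary_fun_def by metis
  have "UNIV - (\<Union>j. T j) \<in> null_sets lebesgue"
    using T by (auto simp: null_sets_def intro!: sets.compl_sets[where M = lebesgue, simplified])
  then have "AE t in lebesgue. t \<in> (\<Union>j. T j)"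
    by (auto dest: AE_not_in)
  then have "AE t in lebesgue. f t \<in> range x"
    by eventually_elim (use T in auto)
  then show thesis
    by (rule that[rotated]) auto
qed

lemma trunc_metric_less_iff: "r \<le> 1 \<Longrightarrow> trunc_metric d x y < r \<longleftrightarrow> d x y < r"
  by (auto simp: trunc_metric_def)

text \<open>The \<open>n\<close>-th elementary approximant is taken within
  \<open>1 / (n + 1)\<close>, which is at most 1, so the truncation disappears and the approximants
  converge a.e. in the original metric. Their values, countably many up to a null set, form the set
  \<open>C\<close>. This essential separability later supplies the countable families of
  centres.\<close>

lemma measurable_funs_trunc_metric:
  fixes f :: "real \<Rightarrow> 'a::metric_space"
  assumes "f \<in> measurable_funs (trunc_metric dist)"
  shows "f \<in> borel_measurable lebesgue"
    and "\<exists>C. countable C \<and> (AE t in lebesgue. f t \<in> closure C)"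
proof -
  have "\<exists>e. elementary_fun e \<and>
      esssup lebesgue (\<lambda>t. ennreal (trunc_metric dist (f t) (e t))) < ennreal (inverse (real (Suc n)))" for n
    using assms unfolding measurable_funs_def by (simp del: of_nat_Suc)
  then obtain e where e: "\<And>n. elementary_fun (e n)"
    "\<And>n. esssup lebesgue (\<lambda>t. ennreal (trunc_metric dist (f t) (e n t))) < ennreal (inverse (real (Suc n)))"
    by metis
  have "AE t in lebesgue. dist (f t) (e n t) < inverse (real (Suc n))" for n
    using esssup_AE[of "\<lambda>t. ennreal (trunc_metric dist (f t) (e n t))" lebesgue]
  proof eventually_elim
    case (elim t)
    then have "ennreal (trunc_metric dist (f t) (e n t)) < ennreal (inverse (real (Suc n)))"
      using e(2)[of n] by (rule le_less_trans)
    then have "trunc_metric dist (f t) (e n t) < inverse (real (Suc n))"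
      by (simp add: ennreal_less_iff trunc_metric_def)
    then show ?case
      by (subst (asm) trunc_metric_less_iff) (auto simp: inverse_eq_divide)
  qed
  then have ae: "AE t in lebesgue. \<forall>n. dist (f t) (e n t) < inverse (real (Suc n))"
    by (simp add: AE_all_countable)
  have lim: "(\<lambda>n. e n t) \<longlonglongrightarrow> f t" if "\<forall>n. dist (f t) (e n t) < inverse (real (Suc n))" for t
  proof (rule metric_tendsto_imp_tendsto[OF LIMSEQ_inverse_real_of_nat])
    show "\<forall>\<^sub>F n in sequentially. dist (e n t) (f t) \<le> dist (inverse (real (Suc n))) 0"
      using that by (auto simp: dist_commute less_imp_le simp del: of_nat_Suc)
  qed
  obtain N where N: "N \<in> null_sets lebesgue"
      "{t \<in> space lebesgue. \<not> (\<forall>n. dist (f t) (e n t) < inverse (real (Suc n)))} \<subseteq> N"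
    using ae unfolding eventually_ae_filter by auto
  have aeN: "AE t in lebesgue. t \<notin> N"
    using N by (auto intro: AE_not_in)
  have [measurable]: "N \<in> sets lebesgue" "\<And>n. e n \<in> borel_measurable lebesgue"
    using N elementary_fun_borel_measurable[OF e(1)] by auto
  \<comment> \<open>A constant value on the null set \<open>N\<close> turns a.e. convergence into
    convergence everywhere; completeness of the measure then leads back to \<open>f\<close>.\<close>
  have "(\<lambda>t. if t \<in> N then undefined else f t) \<in> borel_measurable lebesgue"
  proof (rule borel_measurable_LIMSEQ_metric)
    show "(\<lambda>t. if t \<in> N then undefined else e n t) \<in> borel_measurable lebesgue" for n
      by measurable
    show "(\<lambda>n. if t \<in> N then undefined else e n t) \<longlonglongrightarrow> (if t \<in> N then undefined else f t)" for t
      using N(2) lim[of t] by auto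
  qed
  then show "f \<in> borel_measurable lebesgue"
    by (rule borel_measurable_lebesgue_AE_cong) (use aeN in eventually_elim, auto)
  have "\<exists>C. countable C \<and> (AE t in lebesgue. e n t \<in> C)" for n
    using elementary_fun_AE_countable[OF e(1)[of n]] by metis
  then obtain C where C: "\<And>n. countable (C n)" "\<And>n. AE t in lebesgue. e n t \<in> C n"
    by metis
  have "AE t in lebesgue. \<forall>n. e n t \<in> C n"
    using C(2) by (simp add: AE_all_countable)
  with ae have "AE t in lebesgue. f t \<in> closure (\<Union>n. C n)"
  proof eventually_elim
    case (elim t)
    then show ?case
      unfolding closure_sequential using lim[of t] by (intro exI[of _ "\<lambda>n. e n t"]) auto
  qed
  then show "\<exists>C. countable C \<and> (AE t in lebesgue. f t \<in> closure C)"
    using C(1) by (intro exI[of _ "\<Union>n. C n"]) auto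
qed

section \<open>Upper means\<close>

text \<open>\<open>ennreal_le_epsilon\<close> leaves the case of finite upper limits; there each
  function eventually stays below its own upper limit plus \<open>e / 2\<close>.\<close>

lemma Limsup_add_le_ennreal:
  fixes X Y :: "'a \<Rightarrow> ennreal"
  shows "Limsup F (\<lambda>x. X x + Y x) \<le> Limsup F X + Limsup F Y"
proof (rule ennreal_le_epsilon)
  fix e :: real
  assume fin: "Limsup F X + Limsup F Y < top" and e: "0 < e"
  have half: "\<forall>\<^sub>F x in F. Z x < Limsup F Z + ennreal (e / 2)" if "Limsup F Z < top" for Z
  proof -
    have "Limsup F Z < Limsup F Z + ennreal (e / 2)"
      using that e by (cases "Limsup F Z" rule: ennreal_cases) (auto simp: ennreal_less_iff simp flip: ennreal_plus)
    then show ?thesis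
      using Limsup_le_iff[of F Z "Limsup F Z"] by blast
  qed
  have XY: "Limsup F X < top" "Limsup F Y < top"
    using fin by auto
  have "\<forall>\<^sub>F x in F. X x + Y x \<le> Limsup F X + Limsup F Y + ennreal e"
    using half[of X, OF XY(1)] half[of Y, OF XY(2)]
  proof eventually_elim
    case (elim x)
    have "X x + Y x \<le> (Limsup F X + ennreal (e / 2)) + (Limsup F Y + ennreal (e / 2))"
      using elim by (intro add_mono) auto
    also have "\<dots> = Limsup F X + Limsup F Y + (ennreal (e / 2) + ennreal (e / 2))"
      by (simp add: ac_simps)
    also have "ennreal (e / 2) + ennreal (e / 2) = ennreal e"
      using e by (simp flip: ennreal_plus)
    finally show ?case .
  qed
  then show "Limsup F (\<lambda>x. X x + Y x) \<le> Limsup F X + Limsup F Y + ennreal e"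
    by (rule Limsup_bounded)
qed

lemma Limsup_cmult_ennreal:
  fixes X :: "'a \<Rightarrow> ennreal"
  assumes "F \<noteq> bot"
  shows "Limsup F (\<lambda>x. ennreal c * X x) = ennreal c * Limsup F X"
  by (rule Limsup_compose_continuous_mono[OF _ _ assms])
     (auto simp: mono_def mult_left_mono continuous_on_def intro!: ennreal_tendsto_cmult)

text \<open>Reduces convergence in \<open>ennreal\<close> to non-strict bounds by positive reals,
  the form in which the estimates for returning sequences, integrals and codensities arrive.\<close>

lemma tendsto_0_ennreal_iff:
  fixes X :: "'a \<Rightarrow> ennreal"
  shows "(X \<longlongrightarrow> 0) F \<longleftrightarrow> (\<forall>e>0. \<forall>\<^sub>F x in F. X x \<le> ennreal e)"
proof safe
  fix e :: real
  assume "(X \<longlongrightarrow> 0) F" "0 < e"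
  then have "\<forall>\<^sub>F x in F. X x < ennreal e"
    by (intro order_tendstoD(2)) auto
  then show "\<forall>\<^sub>F x in F. X x \<le> ennreal e"
    by eventually_elim auto
next
  assume *: "\<forall>e>0. \<forall>\<^sub>F x in F. X x \<le> ennreal e"
  show "(X \<longlongrightarrow> 0) F"
  proof (rule order_tendstoI)
    fix a :: ennreal
    assume "0 < a"
    then obtain z where z: "0 < z" "z < a"
      using dense by blast
    then obtain e where e: "z = ennreal e" "0 < e"
      by (cases z rule: ennreal_cases) (auto simp: ennreal_less_iff)
    with * have "\<forall>\<^sub>F x in F. X x \<le> ennreal e"
      by blast
    then show "\<forall>\<^sub>F x in F. X x < a"
      by eventually_elim (use z e in auto)
  qed auto
qed

lemma upper_mean_mono:
  assumes "\<And>t. h t \<le> k t"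
  shows "upper_mean h \<le> upper_mean k"
  unfolding upper_mean_def
  by (intro Limsup_mono always_eventually allI divide_right_mono_ennreal nn_integral_mono mult_right_mono ennreal_leI assms) auto

lemma upper_mean_add:
  assumes [measurable]: "h \<in> borel_measurable lebesgue" "k \<in> borel_measurable lebesgue"
    and "\<And>t. 0 \<le> h t" "\<And>t. 0 \<le> k t"
  shows "upper_mean (\<lambda>t. h t + k t) \<le> upper_mean h + upper_mean k"
proof -
  have "(\<integral>\<^sup>+ t\<in>{- b..b}. ennreal (h t + k t) \<partial>lebesgue) / ennreal (2 * b) =
      (\<integral>\<^sup>+ t\<in>{- b..b}. ennreal (h t) \<partial>lebesgue) / ennreal (2 * b) +
      (\<integral>\<^sup>+ t\<in>{- b..b}. ennreal (k t) \<partial>lebesgue) / ennreal (2 * b)" for b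
  proof -
    have "(\<integral>\<^sup>+ t\<in>{- b..b}. ennreal (h t + k t) \<partial>lebesgue) =
        (\<integral>\<^sup>+ t. ennreal (h t) * indicator {- b..b} t + ennreal (k t) * indicator {- b..b} t \<partial>lebesgue)"
      using assms(3,4) by (simp add: distrib_right)
    also have "\<dots> = (\<integral>\<^sup>+ t\<in>{- b..b}. ennreal (h t) \<partial>lebesgue) + (\<integral>\<^sup>+ t\<in>{- b..b}. ennreal (k t) \<partial>lebesgue)"
      by (rule nn_integral_add) measurable
    finally show ?thesis
      by (simp add: add_divide_distrib_ennreal)
  qed
  then show ?thesis
    unfolding upper_mean_def by (simp add: Limsup_add_le_ennreal)
qed

lemma upper_mean_cmult:
  assumes [measurable]: "h \<in> borel_measurable lebesgue" and "0 \<le> c"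
  shows "upper_mean (\<lambda>t. c * h t) = ennreal c * upper_mean h"
proof -
  have "(\<integral>\<^sup>+ t\<in>{- b..b}. ennreal (c * h t) \<partial>lebesgue) / ennreal (2 * b) =
      ennreal c * ((\<integral>\<^sup>+ t\<in>{- b..b}. ennreal (h t) \<partial>lebesgue) / ennreal (2 * b))" for b
  proof -
    have "(\<integral>\<^sup>+ t\<in>{- b..b}. ennreal (c * h t) \<partial>lebesgue) =
        (\<integral>\<^sup>+ t. ennreal c * (ennreal (h t) * indicator {- b..b} t) \<partial>lebesgue)"
      using assms(2) by (simp add: ennreal_mult' mult.assoc)
    also have "\<dots> = ennreal c * (\<integral>\<^sup>+ t\<in>{- b..b}. ennreal (h t) \<partial>lebesgue)"
      by (rule nn_integral_cmult) measurable
    finally show ?thesis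
      by (simp add: ennreal_times_divide)
  qed
  then show ?thesis
    unfolding upper_mean_def by (simp add: Limsup_cmult_ennreal)
qed

section \<open>Translations and windows of fixed length\<close>

lemma shift_measurable_lebesgue [measurable]: "(\<lambda>x::real. x + \<tau>) \<in> lebesgue \<rightarrow>\<^sub>M lebesgue"
  using lebesgue_affine_measurable[of "\<lambda>_::real. 1" \<tau>] by (simp add: add.commute)

lemma nn_integral_shift_interval:
  fixes h :: "real \<Rightarrow> ennreal"
  assumes [measurable]: "h \<in> borel_measurable lebesgue"
  shows "(\<integral>\<^sup>+ t\<in>{a..b}. h (t + \<tau>) \<partial>lebesgue) = (\<integral>\<^sup>+ t\<in>{a + \<tau>..b + \<tau>}. h t \<partial>lebesgue)"
proof -
  have "(\<integral>\<^sup>+ t\<in>{a + \<tau>..b + \<tau>}. h t \<partial>lebesgue) =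
      (\<integral>\<^sup>+ t. h (\<tau> + 1 * t) * indicator {a + \<tau>..b + \<tau>} (\<tau> + 1 * t) \<partial>lebesgue)"
    by (subst nn_integral_real_affine_lebesgue[where c = 1 and t = \<tau>]) auto
  also have "\<dots> = (\<integral>\<^sup>+ t\<in>{a..b}. h (t + \<tau>) \<partial>lebesgue)"
    by (intro nn_integral_cong) (auto simp: indicator_def add.commute)
  finally show ?thesis by simp
qed

lemma nn_integral_windows_le:
  fixes k :: "real \<Rightarrow> ennreal"
  assumes [measurable]: "k \<in> borel_measurable lebesgue"
    and M: "\<And>s. (\<integral>\<^sup>+ t\<in>{s..s + L}. k t \<partial>lebesgue) \<le> M"
  shows "(\<integral>\<^sup>+ t\<in>{s..s + real m * L}. k t \<partial>lebesgue) \<le> of_nat m * M"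
proof -
  \<comment> \<open>Dropping the right endpoint costs nothing, and half-open intervals fit together
    in the induction on \<open>m\<close>.\<close>
  have "AE t in lebesgue. t \<notin> {s + real m * L}"
    by (rule AE_not_in) simp
  then have "AE t in lebesgue. k t * indicator {s..s + real m * L} t \<le> k t * indicator {s..<s + real m * L} t"
    by eventually_elim (auto simp: indicator_def)
  then have "(\<integral>\<^sup>+ t\<in>{s..s + real m * L}. k t \<partial>lebesgue) \<le> (\<integral>\<^sup>+ t\<in>{s..<s + real m * L}. k t \<partial>lebesgue)"
    by (rule nn_integral_mono_AE)
  moreover have "(\<integral>\<^sup>+ t\<in>{s..<s + real m * L}. k t \<partial>lebesgue) \<le> of_nat m * M"
  proof (induction m)
    case (Suc m)
    have "(\<integral>\<^sup>+ t\<in>{s..<s + real (Suc m) * L}. k t \<partial>lebesgue) \<le>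
        (\<integral>\<^sup>+ t. k t * indicator {s..<s + real m * L} t +
          k t * indicator {s + real m * L..s + real m * L + L} t \<partial>lebesgue)"
      by (intro nn_integral_mono) (auto simp: indicator_def algebra_simps)
    also have "\<dots> = (\<integral>\<^sup>+ t\<in>{s..<s + real m * L}. k t \<partial>lebesgue) +
        (\<integral>\<^sup>+ t\<in>{s + real m * L..s + real m * L + L}. k t \<partial>lebesgue)"
      by (rule nn_integral_add) measurable
    also have "\<dots> \<le> of_nat m * M + M"
      by (intro add_mono Suc.IH M)
    finally show ?case
      by (simp add: algebra_simps)
  qed simp
  ultimately show ?thesis
    by (rule order_trans)
qed

lemma nn_integral_window_const:
  assumes "0 \<le> L" and "\<And>t. k t \<le> (c::ennreal)"
  shows "(\<integral>\<^sup>+ t\<in>{s..s + L}. k t \<partial>lebesgue) \<le> c * ennreal L"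
proof -
  have "(\<integral>\<^sup>+ t\<in>{s..s + L}. k t \<partial>lebesgue) \<le> (\<integral>\<^sup>+ t. c * indicator {s..s + L} t \<partial>lebesgue)"
    by (intro nn_integral_mono mult_right_mono assms) auto
  also have "\<dots> = c * ennreal L"
    using assms(1) by (subst nn_integral_cmult_indicator) auto
  finally show ?thesis .
qed

text \<open>The translated interval leaves \<open>{- b..b}\<close> by at most two end pieces of
  length \<open>\<bar>\<tau>\<bar>\<close>. As \<open>h\<close> is at most 1, they contribute at
  most \<open>\<bar>\<tau>\<bar> / b\<close> to the mean, which tends to 0.\<close>

lemma upper_mean_shift_le:
  assumes [measurable]: "h \<in> borel_measurable lebesgue" and h1: "\<And>t. h t \<le> 1"
  shows "upper_mean (\<lambda>t. h (t + \<tau>)) \<le> upper_mean h"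
proof -
  have le: "(\<integral>\<^sup>+ t\<in>{- b..b}. ennreal (h (t + \<tau>)) \<partial>lebesgue) / ennreal (2 * b) \<le>
      (\<integral>\<^sup>+ t\<in>{- b..b}. ennreal (h t) \<partial>lebesgue) / ennreal (2 * b) + ennreal (\<bar>\<tau>\<bar> / b)" if "0 < b" for b
  proof -
    have "(\<integral>\<^sup>+ t\<in>{- b..b}. ennreal (h (t + \<tau>)) \<partial>lebesgue) =
        (\<integral>\<^sup>+ t\<in>{- b + \<tau>..b + \<tau>}. ennreal (h t) \<partial>lebesgue)"
      by (rule nn_integral_shift_interval) measurable
    \<comment> \<open>The left end piece keeps the unsimplified shape \<open>s..s + L\<close> so
      that \<open>nn_integral_window_const\<close> applies to it.\<close>
    also have "\<dots> \<le> (\<integral>\<^sup>+ t. ennreal (h t) * indicator {- b..b} t +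
        (ennreal (h t) * indicator {- b - \<bar>\<tau>\<bar>..- b - \<bar>\<tau>\<bar> + \<bar>\<tau>\<bar>} t + ennreal (h t) * indicator {b..b + \<bar>\<tau>\<bar>} t) \<partial>lebesgue)"
      by (intro nn_integral_mono) (auto simp: indicator_def)
    also have "\<dots> = (\<integral>\<^sup>+ t\<in>{- b..b}. ennreal (h t) \<partial>lebesgue) +
        (\<integral>\<^sup>+ t. ennreal (h t) * indicator {- b - \<bar>\<tau>\<bar>..- b - \<bar>\<tau>\<bar> + \<bar>\<tau>\<bar>} t +
          ennreal (h t) * indicator {b..b + \<bar>\<tau>\<bar>} t \<partial>lebesgue)"
      by (rule nn_integral_add) measurable
    also have "(\<integral>\<^sup>+ t. ennreal (h t) * indicator {- b - \<bar>\<tau>\<bar>..- b - \<bar>\<tau>\<bar> + \<bar>\<tau>\<bar>} t +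
          ennreal (h t) * indicator {b..b + \<bar>\<tau>\<bar>} t \<partial>lebesgue) =
        ((\<integral>\<^sup>+ t\<in>{- b - \<bar>\<tau>\<bar>..- b - \<bar>\<tau>\<bar> + \<bar>\<tau>\<bar>}. ennreal (h t) \<partial>lebesgue) +
        (\<integral>\<^sup>+ t\<in>{b..b + \<bar>\<tau>\<bar>}. ennreal (h t) \<partial>lebesgue))"
      by (rule nn_integral_add) measurable
    also have "(\<integral>\<^sup>+ t\<in>{- b..b}. ennreal (h t) \<partial>lebesgue) +
        ((\<integral>\<^sup>+ t\<in>{- b - \<bar>\<tau>\<bar>..- b - \<bar>\<tau>\<bar> + \<bar>\<tau>\<bar>}. ennreal (h t) \<partial>lebesgue) +
        (\<integral>\<^sup>+ t\<in>{b..b + \<bar>\<tau>\<bar>}. ennreal (h t) \<partial>lebesgue)) \<le>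
        (\<integral>\<^sup>+ t\<in>{- b..b}. ennreal (h t) \<partial>lebesgue) + (1 * ennreal \<bar>\<tau>\<bar> + 1 * ennreal \<bar>\<tau>\<bar>)"
      using h1 by (intro add_left_mono add_mono[OF nn_integral_window_const nn_integral_window_const]) auto
    also have "1 * ennreal \<bar>\<tau>\<bar> + 1 * ennreal \<bar>\<tau>\<bar> = ennreal (2 * \<bar>\<tau>\<bar>)"
      by (simp flip: ennreal_plus)
    finally have "(\<integral>\<^sup>+ t\<in>{- b..b}. ennreal (h (t + \<tau>)) \<partial>lebesgue) / ennreal (2 * b) \<le>
        ((\<integral>\<^sup>+ t\<in>{- b..b}. ennreal (h t) \<partial>lebesgue) + ennreal (2 * \<bar>\<tau>\<bar>)) / ennreal (2 * b)"
      by (rule divide_right_mono_ennreal)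
    also have "\<dots> = (\<integral>\<^sup>+ t\<in>{- b..b}. ennreal (h t) \<partial>lebesgue) / ennreal (2 * b) + ennreal (\<bar>\<tau>\<bar> / b)"
      using that by (subst add_divide_distrib_ennreal) (simp add: divide_ennreal)
    finally show ?thesis .
  qed
  have lim: "((\<lambda>b. ennreal (\<bar>\<tau>\<bar> / b)) \<longlongrightarrow> ennreal 0) at_top"
    by (intro tendsto_ennrealI tendsto_divide_0[OF tendsto_const] filterlim_at_top_imp_at_infinity filterlim_ident)
  have "upper_mean (\<lambda>t. h (t + \<tau>)) \<le> Limsup at_top (\<lambda>b. 
      (\<integral>\<^sup>+ t\<in>{- b..b}. ennreal (h t) \<partial>lebesgue) / ennreal (2 * b) + ennreal (\<bar>\<tau>\<bar> / b))"
    unfolding upper_mean_def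
    by (intro Limsup_mono eventually_mono[OF eventually_gt_at_top[of 0]] le)
  also have "\<dots> \<le> upper_mean h + Limsup at_top (\<lambda>b. ennreal (\<bar>\<tau>\<bar> / b))"
    unfolding upper_mean_def by (rule Limsup_add_le_ennreal)
  also have "Limsup at_top (\<lambda>b. ennreal (\<bar>\<tau>\<bar> / b)) = 0"
    using lim_imp_Limsup[OF _ lim] by simp
  finally show ?thesis by simp
qed

text \<open>Cover \<open>{- b..b}\<close> by about \<open>2 * b / L\<close> windows, each carrying
  at most \<open>M\<close>, and divide by \<open>2 * b\<close>. Finiteness of \<open>M\<close> makes
  multiplication by it commute with the limit in \<open>b\<close>.\<close>

lemma upper_mean_le_windows:
  assumes [measurable]: "h \<in> borel_measurable lebesgue"
    and L: "0 < L" and "M < top"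
    and M: "\<And>s. (\<integral>\<^sup>+ t\<in>{s..s + L}. ennreal (h t) \<partial>lebesgue) \<le> M"
  shows "upper_mean h \<le> M / ennreal L"
proof -
  have le: "(\<integral>\<^sup>+ t\<in>{- b..b}. ennreal (h t) \<partial>lebesgue) / ennreal (2 * b) \<le> M * ennreal (1 / L + 1 / b)"
    if "0 < b" for b
  proof -
    \<comment> \<open>At most two windows more than \<open>2 * b / L\<close>; this surplus becomes
      the vanishing term \<open>M / b\<close>.\<close>
    define m where "m = nat \<lceil>2 * b / L\<rceil> + 1"
    have m: "2 * b / L < real m" "real m \<le> 2 * b / L + 2"
      using that L unfolding m_def by (auto, linarith+)
    have "(\<integral>\<^sup>+ t\<in>{- b..b}. ennreal (h t) \<partial>lebesgue) \<le>
        (\<integral>\<^sup>+ t\<in>{- b..- b + real m * L}. ennreal (h t) \<partial>lebesgue)"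
      using m(1) L by (intro nn_integral_mono) (auto simp: indicator_def field_simps)
    also have "\<dots> \<le> of_nat m * M"
      by (rule nn_integral_windows_le) (auto intro: M)
    also have "\<dots> \<le> ennreal (2 * b / L + 2) * M"
      using m(2) by (intro mult_right_mono) (auto simp: ennreal_of_nat_eq_real_of_nat intro: ennreal_leI)
    finally have "(\<integral>\<^sup>+ t\<in>{- b..b}. ennreal (h t) \<partial>lebesgue) / ennreal (2 * b) \<le>
        ennreal (2 * b / L + 2) * M / ennreal (2 * b)"
      by (rule divide_right_mono_ennreal)
    also have "\<dots> = M * (ennreal (2 * b / L + 2) / ennreal (2 * b))"
      by (simp add: ennreal_times_divide mult.commute)
    also have "ennreal (2 * b / L + 2) / ennreal (2 * b) = ennreal ((2 * b / L + 2) / (2 * b))"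
      using that L by (intro divide_ennreal) auto
    also have "(2 * b / L + 2) / (2 * b) = 1 / L + 1 / b"
      using that L by (simp add: field_simps)
    finally show ?thesis .
  qed
  have "((\<lambda>b. M * ennreal (1 / L + 1 / b)) \<longlongrightarrow> M * ennreal (1 / L + 0)) at_top"
    by (intro ennreal_tendsto_cmult assms tendsto_ennrealI tendsto_add tendsto_const tendsto_divide_0[OF tendsto_const]
        filterlim_at_top_imp_at_infinity filterlim_ident)
  then have lim: "Limsup at_top (\<lambda>b. M * ennreal (1 / L + 1 / b)) = M * ennreal (1 / L)"
    using lim_imp_Limsup[of "at_top :: real filter"] by simp
  have "upper_mean h \<le> Limsup at_top (\<lambda>b. M * ennreal (1 / L + 1 / b))"
    unfolding upper_mean_def
    by (intro Limsup_mono eventually_mono[OF eventually_gt_at_top[of 0]] le)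
  also have "\<dots> = M / ennreal L"
    using L unfolding lim by (simp add: divide_ennreal_def inverse_ennreal inverse_eq_divide)
  finally show ?thesis .
qed

section \<open>Lipschitz functions of almost periodic functions\<close>

lemma ennreal_root_1 [simp]: "ennreal_root 1 x = x"
  by (cases x rule: ennreal_cases) (auto simp: ennreal_root_def)

lemma trunc_metric_nonneg [simp]: "0 \<le> d x y \<Longrightarrow> 0 \<le> trunc_metric d x y"
  by (simp add: trunc_metric_def)

text \<open>Where the metric is cut off at 1, the oscillation of \<Psi> is at most 1 anyway, and
  \<open>1 \<le> L\<close> absorbs it.\<close>

lemma lipschitz_unit_le_trunc_metric:
  fixes \<Psi> :: "'a::metric_space \<Rightarrow> real"
  assumes "L-lipschitz_on UNIV \<Psi>" "range \<Psi> \<subseteq> {0..1}" "1 \<le> L"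
  shows "\<bar>\<Psi> u - \<Psi> v\<bar> \<le> L * trunc_metric dist u v"
proof -
  have "\<bar>\<Psi> u - \<Psi> v\<bar> \<le> L * dist u v"
    using lipschitz_onD[OF assms(1), of u v] by (simp add: dist_real_def)
  moreover have "\<Psi> u \<in> {0..1}" "\<Psi> v \<in> {0..1}"
    using assms(2) by (auto intro: subsetD[OF _ rangeI] simp del: atLeastAtMost_iff)
  then have "\<bar>\<Psi> u - \<Psi> v\<bar> \<le> L * 1"
    using assms(3) by (auto simp: abs_le_iff)
  ultimately show ?thesis
    by (auto simp: trunc_metric_def min_def)
qed

lemma lipschitz_on_UNIV_measurable [measurable_dest]:
  fixes \<Psi> :: "'a::metric_space \<Rightarrow> 'b::metric_space"
  assumes "L-lipschitz_on UNIV \<Psi>"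
  shows "\<Psi> \<in> borel_measurable borel"
  using lipschitz_on_continuous_on[OF assms] by (rule borel_measurable_continuous_onI)

text \<open>Moving a window of length \<open>n\<close> by an almost period changes the integral of
  \<open>\<Psi> \<circ> g\<close> by at most \<eta> per unit length, hence by \<eta> after division
  by \<open>n\<close>. The number \<open>n\<close> comes from the relative density of the almost
  periods alone, so it is the same for every \<Psi>.\<close>

lemma stepanov_ap_upper_mean_le:
  fixes g :: "real \<Rightarrow> 'a::metric_space"
  assumes g: "g \<in> stepanov_ap (trunc_metric dist) x0 1" and \<eta>: "0 < \<eta>"
  obtains n :: nat where "0 < n"
    "\<And>\<Psi>. 1-lipschitz_on UNIV \<Psi> \<Longrightarrow> range \<Psi> \<subseteq> {0..1::real} \<Longrightarrow>
      upper_mean (\<lambda>t. \<Psi> (g t)) \<le>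
        (\<integral>\<^sup>+ t\<in>{0..2 * real n}. ennreal (\<Psi> (g t)) \<partial>lebesgue) / of_nat n + ennreal \<eta>"
proof -
  define E where "E = {\<tau>. stepanov_dist (trunc_metric dist) 1 g (\<lambda>t. g (t + \<tau>)) < ennreal \<eta>}"
  have [measurable]: "g \<in> borel_measurable lebesgue"
    using g by (auto simp: stepanov_ap_def stepanov_bounded_def intro: measurable_funs_trunc_metric)
  have "relatively_dense E"
    using g \<eta> unfolding stepanov_ap_def E_def by blast
  then obtain a where a: "0 < a" "\<And>\<xi>. {\<xi>..\<xi> + a} \<inter> E \<noteq> {}"
    unfolding relatively_dense_def by blast
  \<comment> \<open>With \<open>a \<le> n\<close>, any window of length \<open>n\<close> that starts
    in \<open>{0..a}\<close> lies in \<open>{0..2 * real n}\<close>.\<close>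
  define n where "n = nat \<lceil>a\<rceil>"
  have n: "0 < n" "a \<le> real n"
    using a(1) unfolding n_def by (simp, linarith)
  show thesis
  proof (rule that[OF n(1)])
    fix \<Psi> :: "'a \<Rightarrow> real"
    assume \<Psi>: "1-lipschitz_on UNIV \<Psi>" "range \<Psi> \<subseteq> {0..1}"
    note [measurable] = lipschitz_on_UNIV_measurable[OF \<Psi>(1)]
    have unit: "0 \<le> \<Psi> u" "\<Psi> u \<le> 1" for u
      using subsetD[OF \<Psi>(2) rangeI, of u] by auto
    let ?I = "\<integral>\<^sup>+ t\<in>{0..2 * real n}. ennreal (\<Psi> (g t)) \<partial>lebesgue"
    have "(\<integral>\<^sup>+ t\<in>{s..s + real n}. ennreal (\<Psi> (g t)) \<partial>lebesgue) \<le> ?I + of_nat n * ennreal \<eta>" for s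
    proof -
      \<comment> \<open>An almost period from \<open>{s - a..s}\<close> moves the start
        \<open>s\<close> of the window to \<open>s - \<tau>\<close>, a point of
        \<open>{0..a}\<close>.\<close>
      obtain \<tau> where \<tau>: "\<tau> \<in> E" "s - a \<le> \<tau>" "\<tau> \<le> s"
        using a(2)[of "s - a"] by auto
      have win: "(\<integral>\<^sup>+ t\<in>{\<xi>..\<xi> + 1}. ennreal \<bar>\<Psi> (g (t + \<tau>)) - \<Psi> (g t)\<bar> \<partial>lebesgue) \<le> ennreal \<eta>" for \<xi>
      proof -
        have "(\<integral>\<^sup>+ t\<in>{\<xi>..\<xi> + 1}. ennreal \<bar>\<Psi> (g (t + \<tau>)) - \<Psi> (g t)\<bar> \<partial>lebesgue) \<le>
            (\<integral>\<^sup>+ t\<in>{\<xi>..\<xi> + 1}. ennreal (trunc_metric dist (g t) (g (t + \<tau>)) powr 1) \<partial>lebesgue)"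
          using lipschitz_unit_le_trunc_metric[OF \<Psi>]
          by (intro nn_integral_mono mult_right_mono ennreal_leI) (auto simp: abs_minus_commute)
        also have "\<dots> \<le> stepanov_dist (trunc_metric dist) 1 g (\<lambda>t. g (t + \<tau>))"
          unfolding stepanov_dist_def ennreal_root_1 by (rule SUP_upper) auto
        also have "\<dots> \<le> ennreal \<eta>"
          using \<tau>(1) unfolding E_def by auto
        finally show ?thesis .
      qed
      have "(\<integral>\<^sup>+ t\<in>{s..s + real n}. ennreal (\<Psi> (g t)) \<partial>lebesgue) =
          (\<integral>\<^sup>+ t\<in>{s - \<tau> + \<tau>..s - \<tau> + real n + \<tau>}. ennreal (\<Psi> (g t)) \<partial>lebesgue)"
        by (simp add: algebra_simps)
      also have "\<dots> = (\<integral>\<^sup>+ t\<in>{s - \<tau>..s - \<tau> + real n}. ennreal (\<Psi> (g (t + \<tau>))) \<partial>lebesgue)"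
        by (rule nn_integral_shift_interval[symmetric]) measurable
      also have "\<dots> \<le> (\<integral>\<^sup>+ t. ennreal (\<Psi> (g t)) * indicator {s - \<tau>..s - \<tau> + real n} t +
          ennreal \<bar>\<Psi> (g (t + \<tau>)) - \<Psi> (g t)\<bar> * indicator {s - \<tau>..s - \<tau> + real n} t \<partial>lebesgue)"
      proof (intro nn_integral_mono)
        fix t
        have "ennreal (\<Psi> (g (t + \<tau>))) \<le> ennreal (\<Psi> (g t)) + ennreal \<bar>\<Psi> (g (t + \<tau>)) - \<Psi> (g t)\<bar>"
        proof -
          have "ennreal (\<Psi> (g (t + \<tau>))) \<le> ennreal (\<Psi> (g t) + \<bar>\<Psi> (g (t + \<tau>)) - \<Psi> (g t)\<bar>)"
            by (rule ennreal_leI) simp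
          then show ?thesis
            by (simp add: unit)
        qed
        then show "ennreal (\<Psi> (g (t + \<tau>))) * indicator {s - \<tau>..s - \<tau> + real n} t \<le>
            ennreal (\<Psi> (g t)) * indicator {s - \<tau>..s - \<tau> + real n} t +
            ennreal \<bar>\<Psi> (g (t + \<tau>)) - \<Psi> (g t)\<bar> * indicator {s - \<tau>..s - \<tau> + real n} t"
          by (simp add: indicator_def)
      qed
      also have "\<dots> = (\<integral>\<^sup>+ t\<in>{s - \<tau>..s - \<tau> + real n}. ennreal (\<Psi> (g t)) \<partial>lebesgue) +
          (\<integral>\<^sup>+ t\<in>{s - \<tau>..s - \<tau> + real n}. ennreal \<bar>\<Psi> (g (t + \<tau>)) - \<Psi> (g t)\<bar> \<partial>lebesgue)"
        by (rule nn_integral_add) measurable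
      also have "\<dots> \<le> ?I + of_nat n * ennreal \<eta>"
      proof (rule add_mono)
        show "(\<integral>\<^sup>+ t\<in>{s - \<tau>..s - \<tau> + real n}. ennreal (\<Psi> (g t)) \<partial>lebesgue) \<le> ?I"
          using \<tau> n by (intro nn_integral_mono) (auto simp: indicator_def)
        show "(\<integral>\<^sup>+ t\<in>{s - \<tau>..s - \<tau> + real n}. ennreal \<bar>\<Psi> (g (t + \<tau>)) - \<Psi> (g t)\<bar> \<partial>lebesgue) \<le>
          of_nat n * ennreal \<eta>"
          using nn_integral_windows_le[where L = 1 and m = n and s = "s - \<tau>", OF _ win] by simp
      qed
      finally show ?thesis .
    qed
    moreover have "?I + of_nat n * ennreal \<eta> < top"
    proof -
      have "?I \<le> 1 * ennreal (2 * real n)"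
        using nn_integral_window_const[of "2 * real n" "\<lambda>t. ennreal (\<Psi> (g t))" 1 0] unit by simp
      then have "?I < top"
        by (rule le_less_trans) (simp add: ennreal_mult_less_top)
      then show ?thesis
        by (simp add: ennreal_mult_less_top ennreal_of_nat_eq_real_of_nat)
    qed
    ultimately have "upper_mean (\<lambda>t. \<Psi> (g t)) \<le> (?I + of_nat n * ennreal \<eta>) / ennreal (real n)"
      using n(1) by (intro upper_mean_le_windows) auto
    also have "\<dots> = ?I / of_nat n + of_nat n * ennreal \<eta> / of_nat n"
      by (simp add: add_divide_distrib_ennreal ennreal_of_nat_eq_real_of_nat)
    also have "of_nat n * ennreal \<eta> / of_nat n = ennreal (real n * \<eta>) / ennreal (real n)"
      by (simp add: ennreal_of_nat_eq_real_of_nat ennreal_mult')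
    also have "\<dots> = ennreal \<eta>"
      using n(1) \<eta> by (subst divide_ennreal) auto
    finally show "upper_mean (\<lambda>t. \<Psi> (g t)) \<le> ?I / of_nat n + ennreal \<eta>" .
  qed
qed

lemma besicovitch_dist_p_1:
  assumes "\<And>x y. 0 \<le> d x y"
  shows "besicovitch_dist_p d 1 f g = upper_mean (\<lambda>t. d (f t) (g t))"
  using assms by (simp add: besicovitch_dist_p_def)

lemma besicovitch_apD:
  fixes f :: "real \<Rightarrow> 'a::metric_space"
  assumes "f \<in> besicovitch_ap dist x0"
  shows "f \<in> measurable_funs (trunc_metric dist)"
    and "\<And>\<epsilon>. 0 < \<epsilon> \<Longrightarrow> \<exists>g\<in>stepanov_ap (trunc_metric dist) x0 1.
      upper_mean (\<lambda>t. trunc_metric dist (f t) (g t)) < ennreal \<epsilon>"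
  using assms
  by (auto simp: besicovitch_ap_def besicovitch_ap_p_def besicovitch_bounded_def besicovitch_dist_p_1)

lemma stepanov_apD:
  assumes "g \<in> stepanov_ap d x0 p"
  shows "g \<in> measurable_funs d"
    and "\<And>\<epsilon>. 0 < \<epsilon> \<Longrightarrow> relatively_dense {\<tau>. stepanov_dist d p g (\<lambda>t. g (t + \<tau>)) < ennreal \<epsilon>}"
  using assms by (auto simp: stepanov_ap_def stepanov_bounded_def)

text \<open>Serves for two pairs: \<open>f\<close> with a Stepanov approximant, and \<open>f\<close>
  with a translate of itself.\<close>

lemma upper_mean_lipschitz_le:
  fixes f g :: "real \<Rightarrow> 'a::metric_space"
  assumes [measurable]: "f \<in> borel_measurable lebesgue" "g \<in> borel_measurable lebesgue"
    and \<Psi>: "L-lipschitz_on UNIV \<Psi>" "range \<Psi> \<subseteq> {0..1}" "1 \<le> L"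
  shows "upper_mean (\<lambda>t. \<bar>\<Psi> (f t) - \<Psi> (g t)\<bar>) \<le>
    ennreal L * upper_mean (\<lambda>t. trunc_metric dist (f t) (g t))"
proof -
  note [measurable] = lipschitz_on_UNIV_measurable[OF \<Psi>(1)]
  have "upper_mean (\<lambda>t. \<bar>\<Psi> (f t) - \<Psi> (g t)\<bar>) = upper_mean (\<lambda>t. L * (\<bar>\<Psi> (f t) - \<Psi> (g t)\<bar> / L))"
    using \<Psi>(3) by simp
  also have "\<dots> = ennreal L * upper_mean (\<lambda>t. \<bar>\<Psi> (f t) - \<Psi> (g t)\<bar> / L)"
    using \<Psi>(3) by (intro upper_mean_cmult) auto
  also have "\<dots> \<le> ennreal L * upper_mean (\<lambda>t. trunc_metric dist (f t) (g t))"
    using lipschitz_unit_le_trunc_metric[OF \<Psi>] \<Psi>(3)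
    by (intro mult_left_mono upper_mean_mono) (auto simp: field_simps)
  finally show ?thesis .
qed

text \<open>Half of \<eta> pays for replacing \<open>f\<close> by a Stepanov function
  \<open>g\<close>, the other half for the passage to one window. The point is the order of
  quantifiers: \<open>g\<close> and \<open>n\<close> are fixed before \<Psi>, so several \<Psi> can
  be compared, or a limit taken, under one integral.\<close>

lemma besicovitch_ap_upper_mean_le:
  fixes f :: "real \<Rightarrow> 'a::metric_space"
  assumes f: "f \<in> besicovitch_ap dist x0" and \<eta>: "0 < \<eta>"
  obtains g and n :: nat where "g \<in> stepanov_ap (trunc_metric dist) x0 1" "0 < n"
    "\<And>\<Psi>. 1-lipschitz_on UNIV \<Psi> \<Longrightarrow> range \<Psi> \<subseteq> {0..1::real} \<Longrightarrow>
      upper_mean (\<lambda>t. \<Psi> (f t)) \<le>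
        (\<integral>\<^sup>+ t\<in>{0..2 * real n}. ennreal (\<Psi> (g t)) \<partial>lebesgue) / of_nat n + ennreal \<eta>"
proof -
  obtain g where g: "g \<in> stepanov_ap (trunc_metric dist) x0 1"
      "upper_mean (\<lambda>t. trunc_metric dist (f t) (g t)) < ennreal (\<eta> / 2)"
    using besicovitch_apD(2)[OF f, of "\<eta> / 2"] \<eta> by auto
  obtain n :: nat where n: "0 < n"
    "\<And>\<Psi>. 1-lipschitz_on UNIV \<Psi> \<Longrightarrow> range \<Psi> \<subseteq> {0..1::real} \<Longrightarrow>
      upper_mean (\<lambda>t. \<Psi> (g t)) \<le>
        (\<integral>\<^sup>+ t\<in>{0..2 * real n}. ennreal (\<Psi> (g t)) \<partial>lebesgue) / of_nat n + ennreal (\<eta> / 2)"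
    using stepanov_ap_upper_mean_le[OF g(1), of "\<eta> / 2"] \<eta> by auto
  note [measurable] = measurable_funs_trunc_metric(1)[OF besicovitch_apD(1)[OF f]]
    measurable_funs_trunc_metric(1)[OF stepanov_apD(1)[OF g(1)]]
  show thesis
  proof (rule that[OF g(1) n(1)])
    fix \<Psi> :: "'a \<Rightarrow> real"
    assume \<Psi>: "1-lipschitz_on UNIV \<Psi>" "range \<Psi> \<subseteq> {0..1}"
    note [measurable] = lipschitz_on_UNIV_measurable[OF \<Psi>(1)]
    have unit: "0 \<le> \<Psi> u" for u
      using subsetD[OF \<Psi>(2) rangeI, of u] by auto
    have "upper_mean (\<lambda>t. \<Psi> (f t)) \<le> upper_mean (\<lambda>t. \<Psi> (g t) + \<bar>\<Psi> (f t) - \<Psi> (g t)\<bar>)"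
      by (rule upper_mean_mono) simp
    also have "\<dots> \<le> upper_mean (\<lambda>t. \<Psi> (g t)) + upper_mean (\<lambda>t. \<bar>\<Psi> (f t) - \<Psi> (g t)\<bar>)"
      by (rule upper_mean_add) (measurable, auto simp: unit)
    also have "\<dots> \<le> ((\<integral>\<^sup>+ t\<in>{0..2 * real n}. ennreal (\<Psi> (g t)) \<partial>lebesgue) / of_nat n + ennreal (\<eta> / 2)) +
        ennreal (\<eta> / 2)"
    proof (rule add_mono[OF n(2)[OF \<Psi>]])
      have "upper_mean (\<lambda>t. \<bar>\<Psi> (f t) - \<Psi> (g t)\<bar>) \<le>
          ennreal 1 * upper_mean (\<lambda>t. trunc_metric dist (f t) (g t))"
        by (rule upper_mean_lipschitz_le) (use \<Psi> in auto)
      then show "upper_mean (\<lambda>t. \<bar>\<Psi> (f t) - \<Psi> (g t)\<bar>) \<le> ennreal (\<eta> / 2)"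
        using g(2) by simp
    qed
    also have "\<dots> = (\<integral>\<^sup>+ t\<in>{0..2 * real n}. ennreal (\<Psi> (g t)) \<partial>lebesgue) / of_nat n + ennreal \<eta>"
      using \<eta> by (simp add: add.assoc flip: ennreal_plus)
    finally show "upper_mean (\<lambda>t. \<Psi> (f t)) \<le>
        (\<integral>\<^sup>+ t\<in>{0..2 * real n}. ennreal (\<Psi> (g t)) \<partial>lebesgue) / of_nat n + ennreal \<eta>" .
  qed
qed

section \<open>Lipschitz images of Stepanov almost periodic functions\<close>

lemma elementary_fun_compose:
  assumes "elementary_fun e"
  shows "elementary_fun (\<lambda>t. h (e t))"
proof -
  obtain x T where "\<forall>j::nat. T j \<in> sets lebesgue" "disjoint_family T"
      "emeasure lebesgue (UNIV - (\<Union>j. T j)) = 0" "\<forall>j. \<forall>t\<in>T j. e t = x j"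
    using assms unfolding elementary_fun_def by auto
  then show ?thesis
    unfolding elementary_fun_def by (intro exI[of _ "\<lambda>j. h (x j)"] exI[of _ T]) auto
qed

text \<open>\<Psi> enlarges truncated distances at most \<open>L\<close> times, so elementary
  approximants and almost periods of \<open>g\<close> for \<open>\<epsilon> / (2 * L)\<close> serve
  \<open>\<Psi> \<circ> g\<close> for \<epsilon>. The factor 2 keeps the inequality strict after an
  essential supremum or a supremum over windows.\<close>

lemma lipschitz_unit_stepanov_ap:
  fixes g :: "real \<Rightarrow> 'a::metric_space"
  assumes g: "g \<in> stepanov_ap (trunc_metric dist) x0 1"
    and \<Psi>: "L-lipschitz_on UNIV \<Psi>" "range \<Psi> \<subseteq> {0..1}" "1 \<le> L"
  shows "(\<lambda>t. \<Psi> (g t)) \<in> stepanov_ap dist (0::real) 1"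
proof -
  note [measurable] = measurable_funs_trunc_metric(1)[OF stepanov_apD(1)[OF g]]
    lipschitz_on_UNIV_measurable[OF \<Psi>(1)]
  have unit: "0 \<le> \<Psi> u" "\<Psi> u \<le> 1" for u
    using subsetD[OF \<Psi>(2) rangeI, of u] by auto
  have L: "dist (\<Psi> u) (\<Psi> v) \<le> L * trunc_metric dist u v" for u v
    using lipschitz_unit_le_trunc_metric[OF \<Psi>] by (simp add: dist_real_def)
  have "(\<lambda>t. \<Psi> (g t)) \<in> measurable_funs dist"
    unfolding measurable_funs_def
  proof safe
    fix \<epsilon> :: real
    assume \<epsilon>: "0 < \<epsilon>"
    then obtain e where e: "elementary_fun e"
        "esssup lebesgue (\<lambda>t. ennreal (trunc_metric dist (g t) (e t))) < ennreal (\<epsilon> / (2 * L))"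
      using stepanov_apD(1)[OF g] \<Psi>(3) unfolding measurable_funs_def
      by (auto dest!: spec[of _ "\<epsilon> / (2 * L)"])
    have "elementary_fun (\<lambda>t. \<Psi> (e t))"
      using e(1) by (rule elementary_fun_compose)
    moreover have "esssup lebesgue (\<lambda>t. ennreal (dist (\<Psi> (g t)) (\<Psi> (e t)))) \<le> ennreal (\<epsilon> / 2)"
    proof (rule esssup_I)
      have [measurable]: "e \<in> borel_measurable lebesgue"
        by (rule elementary_fun_borel_measurable[OF e(1)])
      show "(\<lambda>t. ennreal (dist (\<Psi> (g t)) (\<Psi> (e t)))) \<in> borel_measurable lebesgue"
        by measurable
      show "AE t in lebesgue. ennreal (dist (\<Psi> (g t)) (\<Psi> (e t))) \<le> ennreal (\<epsilon> / 2)"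
        using esssup_AE[of "\<lambda>t. ennreal (trunc_metric dist (g t) (e t))" lebesgue]
      proof eventually_elim
        case (elim t)
        then have "ennreal (trunc_metric dist (g t) (e t)) < ennreal (\<epsilon> / (2 * L))"
          using e(2) by (rule le_less_trans)
        then have "L * trunc_metric dist (g t) (e t) \<le> \<epsilon> / 2"
          using \<Psi>(3) by (simp add: ennreal_less_iff field_simps)
        then show ?case
          using L[of "g t" "e t"] by (intro ennreal_leI) linarith
      qed
    qed
    then have "esssup lebesgue (\<lambda>t. ennreal (dist (\<Psi> (g t)) (\<Psi> (e t)))) < ennreal \<epsilon>"
      using \<epsilon> by (elim le_less_trans) (simp add: ennreal_less_iff)
    ultimately show "\<exists>h. elementary_fun h \<and> esssup lebesgue (\<lambda>t. ennreal (dist (\<Psi> (g t)) (h t))) < ennreal \<epsilon>"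
      by blast
  qed
  moreover have "(SUP \<xi>::real. \<integral>\<^sup>+ t\<in>{\<xi>..\<xi> + 1}. ennreal (dist (\<Psi> (g t)) 0 powr 1) \<partial>lebesgue) < top"
  proof (rule le_less_trans)
    show "(SUP \<xi>::real. \<integral>\<^sup>+ t\<in>{\<xi>..\<xi> + 1}. ennreal (dist (\<Psi> (g t)) 0 powr 1) \<partial>lebesgue) \<le> 1 * ennreal 1"
      using unit by (intro SUP_least nn_integral_window_const) auto
  qed simp
  moreover have "relatively_dense {\<tau>. stepanov_dist dist 1 (\<lambda>t. \<Psi> (g t)) (\<lambda>t. \<Psi> (g (t + \<tau>))) < ennreal \<epsilon>}"
    if \<epsilon>: "0 < \<epsilon>" for \<epsilon>
  proof -
    have "stepanov_dist dist 1 (\<lambda>t. \<Psi> (g t)) (\<lambda>t. \<Psi> (g (t + \<tau>))) < ennreal \<epsilon>"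
      if \<tau>: "stepanov_dist (trunc_metric dist) 1 g (\<lambda>t. g (t + \<tau>)) < ennreal (\<epsilon> / (2 * L))" for \<tau>
    proof -
      have "(\<integral>\<^sup>+ t\<in>{\<xi>..\<xi> + 1}. ennreal (dist (\<Psi> (g t)) (\<Psi> (g (t + \<tau>))) powr 1) \<partial>lebesgue) \<le> ennreal (\<epsilon> / 2)" for \<xi>
      proof -
        have "(\<integral>\<^sup>+ t\<in>{\<xi>..\<xi> + 1}. ennreal (dist (\<Psi> (g t)) (\<Psi> (g (t + \<tau>))) powr 1) \<partial>lebesgue) =
            (\<integral>\<^sup>+ t. ennreal L * (ennreal (dist (\<Psi> (g t)) (\<Psi> (g (t + \<tau>))) / L) * indicator {\<xi>..\<xi> + 1} t) \<partial>lebesgue)"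
          using \<Psi>(3) by (intro nn_integral_cong) (auto simp: indicator_def simp flip: ennreal_mult)
        also have "\<dots> = ennreal L * (\<integral>\<^sup>+ t\<in>{\<xi>..\<xi> + 1}. ennreal (dist (\<Psi> (g t)) (\<Psi> (g (t + \<tau>))) / L) \<partial>lebesgue)"
          by (rule nn_integral_cmult) measurable
        also have "\<dots> \<le> ennreal L * (\<integral>\<^sup>+ t\<in>{\<xi>..\<xi> + 1}. ennreal (trunc_metric dist (g t) (g (t + \<tau>)) powr 1) \<partial>lebesgue)"
          using L \<Psi>(3) by (intro mult_left_mono nn_integral_mono mult_right_mono ennreal_leI) (auto simp: field_simps)
        also have "\<dots> \<le> ennreal L * stepanov_dist (trunc_metric dist) 1 g (\<lambda>t. g (t + \<tau>))"
          unfolding stepanov_dist_def ennreal_root_1 by (intro mult_left_mono SUP_upper) auto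
        also have "\<dots> \<le> ennreal L * ennreal (\<epsilon> / (2 * L))"
          using \<tau> by (intro mult_left_mono) auto
        also have "\<dots> = ennreal (\<epsilon> / 2)"
          using \<Psi>(3) \<epsilon> by (simp flip: ennreal_mult)
        finally show ?thesis .
      qed
      then have "stepanov_dist dist 1 (\<lambda>t. \<Psi> (g t)) (\<lambda>t. \<Psi> (g (t + \<tau>))) \<le> ennreal (\<epsilon> / 2)"
        unfolding stepanov_dist_def ennreal_root_1 by (intro SUP_least)
      also have "\<dots> < ennreal \<epsilon>"
        using \<epsilon> by (simp add: ennreal_less_iff)
      finally show ?thesis .
    qed
    moreover have "relatively_dense {\<tau>. stepanov_dist (trunc_metric dist) 1 g (\<lambda>t. g (t + \<tau>)) < ennreal (\<epsilon> / (2 * L))}"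
      using \<epsilon> \<Psi>(3) by (intro stepanov_apD(2)[OF g]) auto
    ultimately show ?thesis
      unfolding relatively_dense_def by (elim exE conjE) (intro exI conjI, assumption, fast)
  qed
  ultimately show ?thesis
    by (simp add: stepanov_ap_def stepanov_bounded_def)
qed

section \<open>Sets approximable by Lipschitz functions\<close>

text \<open>
  Common almost periods of several unrelated functions would be hard to produce. Here all sets are approximated
  by Lipschitz functions of the same \<open>f\<close>, so the almost periods and returning sequences of
  \<open>f\<close> serve all of them, and Boolean operations cause no difficulty.
\<close>

definition lipschitz_approximable :: "(real \<Rightarrow> 'a::metric_space) \<Rightarrow> real set \<Rightarrow> bool" where
  "lipschitz_approximable f T \<longleftrightarrow> T \<in> sets lebesgue \<and>
     (\<forall>\<eta>>0. \<exists>L \<Psi>. L-lipschitz_on UNIV \<Psi> \<and> range \<Psi> \<subseteq> {0..1} \<and>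
        upper_mean (\<lambda>t. \<bar>indicator T t - \<Psi> (f t)\<bar>) \<le> ennreal \<eta>)"

text \<open>Lipschitz constants may be enlarged; \<open>1 \<le> L\<close> is what the estimates
  against the truncated metric require.\<close>

lemma lipschitz_approximableE:
  assumes "lipschitz_approximable f T" "0 < \<eta>"
  obtains L \<Psi> where "L-lipschitz_on UNIV \<Psi>" "range \<Psi> \<subseteq> {0..1::real}" "1 \<le> L"
    "upper_mean (\<lambda>t. \<bar>indicator T t - \<Psi> (f t)\<bar>) \<le> ennreal \<eta>"
proof -
  obtain L \<Psi> where "L-lipschitz_on UNIV \<Psi>" "range \<Psi> \<subseteq> {0..1::real}"
      "upper_mean (\<lambda>t. \<bar>indicator T t - \<Psi> (f t)\<bar>) \<le> ennreal \<eta>"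
    using assms unfolding lipschitz_approximable_def by blast
  moreover from this(1) have "(max L 1)-lipschitz_on UNIV \<Psi>"
    by (rule lipschitz_on_mono) auto
  ultimately show thesis
    by (intro that[of "max L 1" \<Psi>]) auto
qed

section \<open>Almost periodicity and modules of approximable sets\<close>

lemma indicator_elementary_fun: "T \<in> sets lebesgue \<Longrightarrow> elementary_fun (indicator T :: real \<Rightarrow> real)"
  unfolding elementary_fun_def
  by (rule exI[of _ "\<lambda>j. if j = 0 then 1 else 0"],
      rule exI[of _ "\<lambda>j. if j = 0 then T else if j = 1 then - T else {}"])
     (auto simp: disjoint_family_on_def indicator_def Compl_in_sets_lebesgue)

lemma upper_mean_le_1:
  assumes "\<And>t. h t \<le> 1"
  shows "upper_mean h \<le> 1"
  unfolding upper_mean_def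
proof (intro Limsup_bounded eventually_mono[OF eventually_gt_at_top[of 0]])
  fix b :: real
  assume b: "0 < b"
  have "(\<integral>\<^sup>+ t\<in>{- b..- b + 2 * b}. ennreal (h t) \<partial>lebesgue) \<le> 1 * ennreal (2 * b)"
    using b assms by (intro nn_integral_window_const) auto
  then have "(\<integral>\<^sup>+ t\<in>{- b..b}. ennreal (h t) \<partial>lebesgue) / ennreal (2 * b) \<le> ennreal (2 * b) / ennreal (2 * b)"
    by (intro divide_right_mono_ennreal) simp
  then show "(\<integral>\<^sup>+ t\<in>{- b..b}. ennreal (h t) \<partial>lebesgue) / ennreal (2 * b) \<le> 1"
    using b by (subst (asm) divide_ennreal) auto
qed

text \<open>If \<open>\<Psi> \<circ> f\<close> is close to the indicator and \<open>g\<close> is a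
  Stepanov approximant of \<open>f\<close>, then \<open>\<Psi> \<circ> g\<close> is a Stepanov
  approximant of the indicator.\<close>

lemma lipschitz_approximable_besicovitch_sets:
  fixes f :: "real \<Rightarrow> 'a::metric_space"
  assumes f: "f \<in> besicovitch_ap dist x0" and T: "lipschitz_approximable f T"
  shows "T \<in> besicovitch_sets"
proof -
  have [measurable]: "T \<in> sets lebesgue"
    using T by (simp add: lipschitz_approximable_def)
  note [measurable] = measurable_funs_trunc_metric(1)[OF besicovitch_apD(1)[OF f]]
  \<comment> \<open>The indicator is elementary and serves as its own approximant.\<close>
  have "esssup lebesgue (\<lambda>t. ennreal (dist (indicator T t :: real) (indicator T t))) < ennreal \<epsilon>" if "0 < \<epsilon>" for \<epsilon>
  proof (rule le_less_trans)
    show "esssup lebesgue (\<lambda>t. ennreal (dist (indicator T t :: real) (indicator T t))) \<le> 0"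
      by (rule esssup_I) auto
  qed (use that in simp)
  then have "(indicator T :: real \<Rightarrow> real) \<in> measurable_funs dist"
    unfolding measurable_funs_def using indicator_elementary_fun[of T] by auto
  moreover have "set_integrable lebesgue {a..b} (\<lambda>t. dist (indicator T t :: real) 0 powr 1)" for a b
    unfolding set_integrable_def
  proof (rule Bochner_Integration.integrable_bound)
    show "integrable lebesgue (indicator {a..b} :: real \<Rightarrow> real)"
      by (rule integrable_real_indicator) (auto simp: emeasure_lborel_Icc_eq)
    show "(\<lambda>t. indicator {a..b} t *\<^sub>R (dist (indicator T t :: real) 0 powr 1)) \<in> borel_measurable lebesgue"
      by measurable
  qed (auto simp: indicator_def)
  moreover have "upper_mean (\<lambda>t. dist (indicator T t :: real) 0 powr 1) < top"
    by (rule le_less_trans[OF upper_mean_le_1]) (auto simp: indicator_def)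
  moreover have "\<exists>h\<in>stepanov_ap dist (0::real) 1. besicovitch_dist_p dist 1 (indicator T) h < ennreal \<epsilon>" if \<epsilon>: "0 < \<epsilon>" for \<epsilon>
  proof -
    obtain L \<Psi> where \<Psi>: "L-lipschitz_on UNIV \<Psi>" "range \<Psi> \<subseteq> {0..1::real}" "1 \<le> L"
        "upper_mean (\<lambda>t. \<bar>indicator T t - \<Psi> (f t)\<bar>) \<le> ennreal (\<epsilon> / 4)"
      using lipschitz_approximableE[OF T, of "\<epsilon> / 4"] \<epsilon> by auto
    \<comment> \<open>The tolerance depends on \<open>L\<close>, so \<open>g\<close> is chosen after
      \<Psi>; the two errors then add up to \<open>\<epsilon> / 2\<close>.\<close>
    obtain g where g: "g \<in> stepanov_ap (trunc_metric dist) x0 1"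
        "upper_mean (\<lambda>t. trunc_metric dist (f t) (g t)) < ennreal (\<epsilon> / (4 * L))"
      using besicovitch_apD(2)[OF f, of "\<epsilon> / (4 * L)"] \<epsilon> \<Psi>(3) by auto
    note [measurable] = measurable_funs_trunc_metric(1)[OF stepanov_apD(1)[OF g(1)]]
      lipschitz_on_UNIV_measurable[OF \<Psi>(1)]
    have "upper_mean (\<lambda>t. dist (indicator T t) (\<Psi> (g t))) \<le>
        upper_mean (\<lambda>t. \<bar>indicator T t - \<Psi> (f t)\<bar> + \<bar>\<Psi> (f t) - \<Psi> (g t)\<bar>)"
      by (rule upper_mean_mono) (simp add: dist_real_def)
    also have "\<dots> \<le> upper_mean (\<lambda>t. \<bar>indicator T t - \<Psi> (f t)\<bar>) + upper_mean (\<lambda>t. \<bar>\<Psi> (f t) - \<Psi> (g t)\<bar>)"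
      by (rule upper_mean_add) measurable
    also have "\<dots> \<le> ennreal (\<epsilon> / 4) + ennreal L * ennreal (\<epsilon> / (4 * L))"
    proof (rule add_mono[OF \<Psi>(4)])
      have "upper_mean (\<lambda>t. \<bar>\<Psi> (f t) - \<Psi> (g t)\<bar>) \<le> ennreal L * upper_mean (\<lambda>t. trunc_metric dist (f t) (g t))"
        by (rule upper_mean_lipschitz_le) (use \<Psi> in auto)
      also have "\<dots> \<le> ennreal L * ennreal (\<epsilon> / (4 * L))"
        using g(2) by (intro mult_left_mono) auto
      finally show "upper_mean (\<lambda>t. \<bar>\<Psi> (f t) - \<Psi> (g t)\<bar>) \<le> ennreal L * ennreal (\<epsilon> / (4 * L))" .
    qed
    also have "\<dots> = ennreal (\<epsilon> / 2)"
      using \<epsilon> \<Psi>(3) by (simp flip: ennreal_mult ennreal_plus)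
    also have "\<dots> < ennreal \<epsilon>"
      using \<epsilon> by (simp add: ennreal_less_iff)
    finally have "besicovitch_dist_p dist 1 (indicator T) (\<lambda>t. \<Psi> (g t)) < ennreal \<epsilon>"
      by (simp add: besicovitch_dist_p_1)
    then show ?thesis
      using lipschitz_unit_stepanov_ap[OF g(1) \<Psi>(1-3)] by blast
  qed
  ultimately show ?thesis
    unfolding besicovitch_sets_def besicovitch_ap_p_def besicovitch_bounded_def by simp
qed

text \<open>The module shrinks as the family of returning sequences grows, so it suffices that every
  sequence returning for \<open>f\<close> is returning for the indicator of
  \<open>T\<close>.\<close>

lemma lipschitz_approximable_Mod_set:
  fixes f :: "real \<Rightarrow> 'a::metric_space"
  assumes f [measurable]: "f \<in> borel_measurable lebesgue" and T: "lipschitz_approximable f T"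
  shows "Mod_set T \<subseteq> Mod_fun dist f"
proof -
  have [measurable]: "T \<in> sets lebesgue"
    using T by (simp add: lipschitz_approximable_def)
  have "returning_seq dist (indicator T :: real \<Rightarrow> real) \<tau>" if \<tau>: "returning_seq dist f \<tau>" for \<tau>
    unfolding returning_seq_def tendsto_0_ennreal_iff
  proof safe
    fix e :: real
    assume e: "0 < e"
    obtain L \<Psi> where \<Psi>: "L-lipschitz_on UNIV \<Psi>" "range \<Psi> \<subseteq> {0..1::real}" "1 \<le> L"
        "upper_mean (\<lambda>t. \<bar>indicator T t - \<Psi> (f t)\<bar>) \<le> ennreal (e / 4)"
      using lipschitz_approximableE[OF T, of "e / 4"] e by auto
    note [measurable] = lipschitz_on_UNIV_measurable[OF \<Psi>(1)]
    let ?h = "\<lambda>t. \<bar>indicator T t - \<Psi> (f t)\<bar>"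
    have h [measurable]: "?h \<in> borel_measurable lebesgue"
      by measurable
    \<comment> \<open>This bound is what \<open>upper_mean_shift_le\<close> asks for.\<close>
    have h1: "?h t \<le> 1" for t
      using subsetD[OF \<Psi>(2) rangeI, of "f t"] by (auto simp: indicator_def)
    have "0 < e / (2 * L)"
      using e \<Psi>(3) by auto
    then have "\<forall>\<^sub>F j in sequentially. besicovitch_dist dist f (\<lambda>t. f (t + \<tau> j)) \<le> ennreal (e / (2 * L))"
      using \<tau> unfolding returning_seq_def tendsto_0_ennreal_iff by blast
    then show "\<forall>\<^sub>F j in sequentially. besicovitch_dist dist (indicator T) (\<lambda>t. indicator T (t + \<tau> j) :: real) \<le> ennreal e"
    proof eventually_elim
      case (elim j)
      let ?k = "\<lambda>t. \<bar>\<Psi> (f t) - \<Psi> (f (t + \<tau> j))\<bar>"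
      have "besicovitch_dist dist (indicator T) (\<lambda>t. indicator T (t + \<tau> j) :: real) \<le>
          upper_mean (\<lambda>t. (?h t + ?h (t + \<tau> j)) + ?k t)"
        unfolding besicovitch_dist_def
      proof (rule upper_mean_mono)
        fix t
        have "trunc_metric dist (indicator T t :: real) (indicator T (t + \<tau> j)) \<le>
            \<bar>indicator T t - indicator T (t + \<tau> j)\<bar>"
          by (simp add: trunc_metric_def dist_real_def)
        \<comment> \<open>The path runs from the indicator at \<open>t\<close> through
          \<open>\<Psi> (f t)\<close> and \<open>\<Psi> (f (t + \<tau> j))\<close> to the indicator
          at \<open>t + \<tau> j\<close>; the last error is a translate of the first.\<close>
        also have "\<dots> \<le> (?h t + ?h (t + \<tau> j)) + ?k t"
          by linarith
        finally show "trunc_metric dist (indicator T t :: real) (indicator T (t + \<tau> j)) \<le>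
            (?h t + ?h (t + \<tau> j)) + ?k t" .
      qed
      also have "\<dots> \<le> upper_mean (\<lambda>t. ?h t + ?h (t + \<tau> j)) + upper_mean ?k"
        by (rule upper_mean_add) measurable
      also have "\<dots> \<le> (upper_mean ?h + upper_mean (\<lambda>t. ?h (t + \<tau> j))) + upper_mean ?k"
        by (intro add_right_mono upper_mean_add) measurable
      also have "\<dots> \<le> (ennreal (e / 4) + ennreal (e / 4)) + ennreal L * ennreal (e / (2 * L))"
      proof (intro add_mono \<Psi>(4))
        have "upper_mean (\<lambda>t. ?h (t + \<tau> j)) \<le> upper_mean ?h"
          by (rule upper_mean_shift_le) (measurable, rule h1)
        also note \<Psi>(4)
        finally show "upper_mean (\<lambda>t. ?h (t + \<tau> j)) \<le> ennreal (e / 4)" .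
        have "upper_mean ?k \<le> ennreal L * upper_mean (\<lambda>t. trunc_metric dist (f t) (f (t + \<tau> j)))"
          by (rule upper_mean_lipschitz_le) (use \<Psi> in auto)
        also have "\<dots> \<le> ennreal L * ennreal (e / (2 * L))"
          using elim unfolding besicovitch_dist_def by (intro mult_left_mono) auto
        finally show "upper_mean ?k \<le> ennreal L * ennreal (e / (2 * L))" .
      qed
      also have "\<dots> = ennreal e"
        using e \<Psi>(3) by (simp flip: ennreal_mult ennreal_plus)
      finally show ?case .
    qed
  qed
  then show ?thesis
    unfolding Mod_set_def Mod_fun_def by blast
qed

section \<open>Boolean operations on approximable sets\<close>

lemma lipschitz_approximable_UNIV: "lipschitz_approximable f UNIV"
  unfolding lipschitz_approximable_def
  by (intro conjI allI impI exI[of _ 0] exI[of _ "\<lambda>_. 1"]) (auto simp: upper_mean_def Limsup_const intro: lipschitz_on_constant)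

lemma lipschitz_approximable_Compl:
  assumes "lipschitz_approximable f T"
  shows "lipschitz_approximable f (- T)"
  unfolding lipschitz_approximable_def
proof (intro conjI allI impI)
  show "- T \<in> sets lebesgue"
    using assms by (simp add: lipschitz_approximable_def Compl_in_sets_lebesgue)
  fix \<eta> :: real
  assume "0 < \<eta>"
  then obtain L \<Psi> where \<Psi>: "L-lipschitz_on UNIV \<Psi>" "range \<Psi> \<subseteq> {0..1::real}"
      "upper_mean (\<lambda>t. \<bar>indicator T t - \<Psi> (f t)\<bar>) \<le> ennreal \<eta>"
    using assms unfolding lipschitz_approximable_def by blast
  have "upper_mean (\<lambda>t. \<bar>indicator (- T) t - (1 - \<Psi> (f t))\<bar>) \<le> ennreal \<eta>"
    by (rule order_trans[OF upper_mean_mono \<Psi>(3)]) (auto simp: indicator_def)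
  moreover have "L-lipschitz_on UNIV (\<lambda>u. 1 - \<Psi> u)"
    using lipschitz_on_diff[OF lipschitz_on_constant \<Psi>(1)] by simp
  ultimately show "\<exists>L \<Phi>. L-lipschitz_on UNIV \<Phi> \<and> range \<Phi> \<subseteq> {0..1} \<and>
      upper_mean (\<lambda>t. \<bar>indicator (- T) t - \<Phi> (f t)\<bar>) \<le> ennreal \<eta>"
    using \<Psi>(2) by (intro exI[of _ L] exI[of _ "\<lambda>u. 1 - \<Psi> u"]) (auto simp: image_subset_iff)
qed

text \<open>The product of the two approximants is again Lipschitz with values in
  \<open>{0..1}\<close>, and it approximates the product of the indicators.\<close>

lemma lipschitz_approximable_Int:
  fixes f :: "real \<Rightarrow> 'a::metric_space"
  assumes [measurable]: "f \<in> borel_measurable lebesgue"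
    and S: "lipschitz_approximable f S" and T: "lipschitz_approximable f T"
  shows "lipschitz_approximable f (S \<inter> T)"
  unfolding lipschitz_approximable_def
proof (intro conjI allI impI)
  have [measurable]: "S \<in> sets lebesgue" "T \<in> sets lebesgue"
    using S T by (auto simp: lipschitz_approximable_def)
  show "S \<inter> T \<in> sets lebesgue"
    by measurable
  fix \<eta> :: real
  assume \<eta>: "0 < \<eta>"
  obtain L \<Psi> where \<Psi>: "L-lipschitz_on UNIV \<Psi>" "range \<Psi> \<subseteq> {0..1::real}" "1 \<le> L"
      "upper_mean (\<lambda>t. \<bar>indicator S t - \<Psi> (f t)\<bar>) \<le> ennreal (\<eta> / 2)"
    using lipschitz_approximableE[OF S, of "\<eta> / 2"] \<eta> by auto
  obtain M \<Phi> where \<Phi>: "M-lipschitz_on UNIV \<Phi>" "range \<Phi> \<subseteq> {0..1::real}" "1 \<le> M"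
      "upper_mean (\<lambda>t. \<bar>indicator T t - \<Phi> (f t)\<bar>) \<le> ennreal (\<eta> / 2)"
    using lipschitz_approximableE[OF T, of "\<eta> / 2"] \<eta> by auto
  note [measurable] = lipschitz_on_UNIV_measurable[OF \<Psi>(1)] lipschitz_on_UNIV_measurable[OF \<Phi>(1)]
  have unit: "0 \<le> \<Psi> u" "\<Psi> u \<le> 1" "0 \<le> \<Phi> u" "\<Phi> u \<le> 1" for u
    using subsetD[OF \<Psi>(2) rangeI, of u] subsetD[OF \<Phi>(2) rangeI, of u] by auto
  \<comment> \<open>Used twice: for the error in upper mean and for the Lipschitz constant
    \<open>L + M\<close>.\<close>
  have prod: "\<bar>a * b - a' * b'\<bar> \<le> \<bar>a - a'\<bar> + \<bar>b - b'\<bar>"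
    if "0 \<le> a" "a \<le> 1" "0 \<le> b'" "b' \<le> 1" for a b a' b' :: real
  proof -
    have "a * b - a' * b' = a * (b - b') + b' * (a - a')"
      by (simp add: algebra_simps)
    also have "\<bar>\<dots>\<bar> \<le> \<bar>a\<bar> * \<bar>b - b'\<bar> + \<bar>b'\<bar> * \<bar>a - a'\<bar>"
      by (metis abs_triangle_ineq abs_mult)
    also have "\<dots> \<le> 1 * \<bar>b - b'\<bar> + 1 * \<bar>a - a'\<bar>"
      using that by (intro add_mono mult_right_mono) auto
    finally show ?thesis by simp
  qed
  have "upper_mean (\<lambda>t. \<bar>indicator (S \<inter> T) t - \<Psi> (f t) * \<Phi> (f t)\<bar>) \<le>
      upper_mean (\<lambda>t. \<bar>indicator S t - \<Psi> (f t)\<bar> + \<bar>indicator T t - \<Phi> (f t)\<bar>)"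
    unfolding indicator_inter_arith by (intro upper_mean_mono prod) (auto simp: unit)
  also have "\<dots> \<le> upper_mean (\<lambda>t. \<bar>indicator S t - \<Psi> (f t)\<bar>) + upper_mean (\<lambda>t. \<bar>indicator T t - \<Phi> (f t)\<bar>)"
    by (rule upper_mean_add) measurable
  also have "\<dots> \<le> ennreal (\<eta> / 2) + ennreal (\<eta> / 2)"
    by (intro add_mono \<Psi> \<Phi>)
  also have "\<dots> = ennreal \<eta>"
    using \<eta> by (simp flip: ennreal_plus)
  finally have "upper_mean (\<lambda>t. \<bar>indicator (S \<inter> T) t - \<Psi> (f t) * \<Phi> (f t)\<bar>) \<le> ennreal \<eta>" .
  moreover have "(L + M)-lipschitz_on UNIV (\<lambda>u. \<Psi> u * \<Phi> u)"
  proof (rule lipschitz_onI)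
    fix u v :: 'a
    have "dist (\<Psi> u * \<Phi> u) (\<Psi> v * \<Phi> v) \<le> \<bar>\<Psi> u - \<Psi> v\<bar> + \<bar>\<Phi> u - \<Phi> v\<bar>"
      unfolding dist_real_def by (rule prod) (auto simp: unit)
    also have "\<dots> \<le> L * dist u v + M * dist u v"
      using lipschitz_onD[OF \<Psi>(1), of u v] lipschitz_onD[OF \<Phi>(1), of u v] by (simp add: dist_real_def)
    finally show "dist (\<Psi> u * \<Phi> u) (\<Psi> v * \<Phi> v) \<le> (L + M) * dist u v"
      by (simp add: distrib_right)
  qed (use \<Psi>(3) \<Phi>(3) in auto)
  moreover have "range (\<lambda>u. \<Psi> u * \<Phi> u) \<subseteq> {0..1}"
    using unit by (auto intro!: mult_le_one mult_nonneg_nonneg)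
  ultimately show "\<exists>L \<Theta>. L-lipschitz_on UNIV \<Theta> \<and> range \<Theta> \<subseteq> {0..1} \<and>
      upper_mean (\<lambda>t. \<bar>indicator (S \<inter> T) t - \<Theta> (f t)\<bar>) \<le> ennreal \<eta>"
    by blast
qed

text \<open>Each disjointed set is \<open>A n\<close> intersected with finitely many complements, so
  the Boolean operations suffice.\<close>

lemma lipschitz_approximable_disjointed:
  fixes f :: "real \<Rightarrow> 'a::metric_space"
  assumes f: "f \<in> borel_measurable lebesgue" and A: "\<And>j. lipschitz_approximable f (A j)"
  shows "lipschitz_approximable f (disjointed A n)"
proof -
  have "lipschitz_approximable f (\<Inter>i<k. - A i)" for k :: nat
  proof (induction k)
    case (Suc k)
    then show ?case
      unfolding lessThan_Suc INT_insert
      by (intro lipschitz_approximable_Int f lipschitz_approximable_Compl A)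
  qed (simp add: lipschitz_approximable_UNIV)
  then have "lipschitz_approximable f (A n \<inter> (\<Inter>i<n. - A i))"
    by (intro lipschitz_approximable_Int f A)
  also have "A n \<inter> (\<Inter>i<n. - A i) = disjointed A n"
    by (auto simp: disjointed_def)
  finally show ?thesis .
qed

section \<open>Radii and finite nets\<close>

text \<open>A tent over the sphere of radius \<open>r\<close> around \<open>x\<close>. Its height is
  \<delta> rather than 1, which keeps the slope 1 and hence the Lipschitz constant independent of
  \<delta>.\<close>

definition spike :: "'a::metric_space \<Rightarrow> real \<Rightarrow> real \<Rightarrow> 'a \<Rightarrow> real" where
  "spike x \<delta> r u = max 0 (\<delta> - \<bar>dist u x - r\<bar>)"

lemma spike_lipschitz: "1-lipschitz_on UNIV (spike x \<delta> r)"
proof (rule lipschitz_onI)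
  fix u v
  have "\<bar>dist u x - dist v x\<bar> \<le> dist u v"
    using abs_dist_diff_le[of u x v] by (simp add: dist_commute)
  then show "dist (spike x \<delta> r u) (spike x \<delta> r v) \<le> 1 * dist u v"
    unfolding spike_def dist_real_def by linarith
qed simp

lemma spike_bounds: "0 \<le> spike x \<delta> r u" "0 \<le> \<delta> \<Longrightarrow> spike x \<delta> r u \<le> \<delta>"
  by (auto simp: spike_def)

text \<open>Radii at least \<open>2 * \<delta>\<close> apart give tents with disjoint supports, so
  at most one summand is nonzero at any \<open>u\<close>.\<close>

lemma sum_spike_le:
  assumes "finite F" "0 < \<delta>" and sep: "\<And>r s. r \<in> F \<Longrightarrow> s \<in> F \<Longrightarrow> r \<noteq> s \<Longrightarrow> 2 * \<delta> \<le> \<bar>r - s\<bar>"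
  shows "(\<Sum>r\<in>F. spike x \<delta> r u) \<le> \<delta>"
proof (cases "\<exists>r\<in>F. spike x \<delta> r u \<noteq> 0")
  case True
  then obtain r where r: "r \<in> F" "spike x \<delta> r u \<noteq> 0"
    by blast
  have "spike x \<delta> s u = 0" if "s \<in> F - {r}" for s
    using sep[of r s] that r unfolding spike_def by (auto simp: max_def split: if_splits)
  then have "(\<Sum>s\<in>F. spike x \<delta> s u) = spike x \<delta> r u"
    using assms(1) r(1) by (subst sum.remove[of F r]) auto
  then show ?thesis
    using spike_bounds(2)[of \<delta> x r u] assms(2) by simp
next
  case False
  then show ?thesis
    using assms(2) by simp
qed

lemma finite_separation:
  fixes F :: "real set"
  assumes "finite F"
  obtains \<delta> where "0 < \<delta>" "\<delta> \<le> 1" "\<And>r s. r \<in> F \<Longrightarrow> s \<in> F \<Longrightarrow> r \<noteq> s \<Longrightarrow> 2 * \<delta> \<le> \<bar>r - s\<bar>"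
proof -
  \<comment> \<open>The element 1 yields \<open>\<delta> \<le> 1\<close> and keeps \<open>D\<close>
    nonempty when \<open>F\<close> has fewer than two points.\<close>
  define D where "D = insert 1 ((\<lambda>(r, s). \<bar>r - s\<bar> / 2) ` {p \<in> F \<times> F. fst p \<noteq> snd p})"
  have D: "finite D" "1 \<in> D" "\<And>d. d \<in> D \<Longrightarrow> 0 < d"
    using assms unfolding D_def by (auto intro: finite_subset[of _ "F \<times> F"])
  show thesis
  proof (rule that[of "Min D"])
    show "0 < Min D"
      using D by (subst Min_gr_iff) auto
    show "Min D \<le> 1"
      using D by (intro Min_le) auto
    fix r s
    assume rs: "r \<in> F" "s \<in> F" "r \<noteq> s"
    then have "\<bar>r - s\<bar> / 2 \<in> D"
      unfolding D_def by (force intro!: image_eqI[of _ _ "(r, s)"])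
    then have "Min D \<le> \<bar>r - s\<bar> / 2"
      using D by (intro Min_le)
    then show "2 * Min D \<le> \<bar>r - s\<bar>"
      by simp
  qed
qed

text \<open>
  Upper means are only subadditive, but on the finite window provided by
  \<open>besicovitch_ap_upper_mean_le\<close> they are dominated by genuine integrals. So the upper means of
  spikes with disjoint supports cannot all be large.
\<close>

lemma finite_bad_radii:
  fixes f :: "real \<Rightarrow> 'a::metric_space"
  assumes f: "f \<in> besicovitch_ap dist x0" and c: "0 < c"
  shows "finite {r. \<forall>\<delta>. 0 < \<delta> \<longrightarrow> \<delta> \<le> 1 \<longrightarrow> ennreal (c * \<delta>) \<le> upper_mean (\<lambda>t. spike x \<delta> r (f t))}" (is "finite ?B")
proof (rule ccontr)
  assume "infinite ?B"
  \<comment> \<open>The count below ends in \<open>N * c \<le> 4\<close>, so any number above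
    \<open>4 / c\<close> gives the contradiction.\<close>
  define N where "N = nat \<lceil>4 / c\<rceil> + 1"
  obtain F where F: "F \<subseteq> ?B" "finite F" "card F = N"
    using infinite_arbitrarily_large[OF \<open>infinite ?B\<close>] by blast
  have N: "4 < real N * c"
  proof -
    have "4 / c < real N"
      unfolding N_def by linarith
    then show ?thesis
      using c by (simp add: field_simps)
  qed
  \<comment> \<open>A bad radius is bad for every width up to 1, so one common width may be chosen
    after \<open>F\<close>.\<close>
  obtain \<delta> where \<delta>: "0 < \<delta>" "\<delta> \<le> 1" "\<And>r s. r \<in> F \<Longrightarrow> s \<in> F \<Longrightarrow> r \<noteq> s \<Longrightarrow> 2 * \<delta> \<le> \<bar>r - s\<bar>"
    using finite_separation[OF F(2)] by blast
  \<comment> \<open>With this error, half of the lower bound \<open>c * \<delta>\<close> for each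
    bad spike survives on the window.\<close>
  have "0 < c * \<delta> / 2"
    using c \<delta>(1) by simp
  from besicovitch_ap_upper_mean_le[OF f this]
  obtain g and n :: nat where g: "g \<in> stepanov_ap (trunc_metric dist) x0 1" and n: "0 < n" and
    le: "\<And>\<Psi>. 1-lipschitz_on UNIV \<Psi> \<Longrightarrow> range \<Psi> \<subseteq> {0..1::real} \<Longrightarrow>
      upper_mean (\<lambda>t. \<Psi> (f t)) \<le>
        (\<integral>\<^sup>+ t\<in>{0..2 * real n}. ennreal (\<Psi> (g t)) \<partial>lebesgue) / of_nat n + ennreal (c * \<delta> / 2)"
    by blast
  note [measurable] = measurable_funs_trunc_metric(1)[OF stepanov_apD(1)[OF g]]
    lipschitz_on_UNIV_measurable[OF spike_lipschitz]
  let ?I = "\<lambda>r. \<integral>\<^sup>+ t\<in>{0..2 * real n}. ennreal (spike x \<delta> r (g t)) \<partial>lebesgue"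
  have "(\<Sum>r\<in>F. ?I r) = (\<integral>\<^sup>+ t. (\<Sum>r\<in>F. ennreal (spike x \<delta> r (g t)) * indicator {0..2 * real n} t) \<partial>lebesgue)"
    by (rule nn_integral_sum[symmetric]) measurable
  also have "\<dots> = (\<integral>\<^sup>+ t\<in>{0..0 + 2 * real n}. ennreal (\<Sum>r\<in>F. spike x \<delta> r (g t)) \<partial>lebesgue)"
    by (intro nn_integral_cong) (simp add: sum_distrib_right[symmetric] sum_ennreal spike_bounds)
  also have "\<dots> \<le> ennreal \<delta> * ennreal (2 * real n)"
    by (intro nn_integral_window_const ennreal_leI sum_spike_le F(2) \<delta>) auto
  finally have I: "(\<Sum>r\<in>F. ?I r) \<le> ennreal (\<delta> * (2 * real n))"
    using \<delta>(1) by (simp add: ennreal_mult)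
  have const: "(\<Sum>r\<in>F. ennreal d) = ennreal (real N * d)" for d
    using F(3) by (simp add: ennreal_mult' ennreal_of_nat_eq_real_of_nat)
  have "ennreal (real N * (c * \<delta>)) = (\<Sum>r\<in>F. ennreal (c * \<delta>))"
    by (rule const[symmetric])
  also have "\<dots> \<le> (\<Sum>r\<in>F. ?I r / of_nat n + ennreal (c * \<delta> / 2))"
  proof (rule sum_mono)
    fix r
    assume "r \<in> F"
    then have "ennreal (c * \<delta>) \<le> upper_mean (\<lambda>t. spike x \<delta> r (f t))"
      using F(1) \<delta> by auto
    also have "\<dots> \<le> ?I r / of_nat n + ennreal (c * \<delta> / 2)"
    proof (rule le[OF spike_lipschitz])
      show "range (spike x \<delta> r) \<subseteq> {0..1}"
        using \<delta>(1,2) by (auto simp: spike_def)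
    qed
    finally show "ennreal (c * \<delta>) \<le> ?I r / of_nat n + ennreal (c * \<delta> / 2)" .
  qed
  also have "\<dots> = (\<Sum>r\<in>F. ?I r) / of_nat n + ennreal (real N * (c * \<delta> / 2))"
    unfolding sum.distrib const divide_ennreal_def sum_distrib_right ..
  also have "\<dots> \<le> ennreal (\<delta> * (2 * real n)) / of_nat n + ennreal (real N * (c * \<delta> / 2))"
    by (intro add_right_mono divide_right_mono_ennreal I)
  also have "ennreal (\<delta> * (2 * real n)) / of_nat n = ennreal (2 * \<delta>)"
    using n \<delta>(1) by (simp add: ennreal_of_nat_eq_real_of_nat divide_ennreal)
  also have "ennreal (2 * \<delta>) + ennreal (real N * (c * \<delta> / 2)) = ennreal (2 * \<delta> + real N * (c * \<delta> / 2))"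
    using c \<delta>(1) by (subst ennreal_plus) auto
  finally have "real N * (c * \<delta>) \<le> 2 * \<delta> + real N * (c * \<delta> / 2)"
    using c \<delta>(1) by (subst (asm) ennreal_le_iff) auto
  then have "(real N * c) * \<delta> \<le> 4 * \<delta>"
    by (simp add: field_simps)
  with N \<delta>(1) show False
    by simp
qed

text \<open>For each \<open>k\<close> only finitely many radii are bad with constant
  \<open>1 / (k + 1)\<close>, so an open interval contains a radius that is good for all
  \<open>k\<close>. Around its sphere thin shells carry arbitrarily small mean relative to their
  width.\<close>

lemma exists_approximable_radius:
  fixes f :: "real \<Rightarrow> 'a::metric_space"
  assumes f: "f \<in> besicovitch_ap dist x0" and "a < b"
  obtains r where "a < r" "r < b" "lipschitz_approximable f {t. dist (f t) x < r}"
proof -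
  define B where "B c = {r. \<forall>\<delta>. 0 < \<delta> \<longrightarrow> \<delta> \<le> 1 \<longrightarrow> ennreal (c * \<delta>) \<le> upper_mean (\<lambda>t. spike x \<delta> r (f t))}" for c
  have "countable (\<Union>k. B (inverse (real (Suc k))))"
    unfolding B_def by (rule countable_UN) (auto intro!: countable_finite finite_bad_radii[OF f] simp del: of_nat_Suc)
  moreover have "uncountable {a<..<b}"
    using \<open>a < b\<close> by (simp add: uncountable_open_interval)
  ultimately have "\<not> {a<..<b} \<subseteq> (\<Union>k. B (inverse (real (Suc k))))"
    using countable_subset by blast
  then obtain r where r: "a < r" "r < b" "\<And>k. r \<notin> B (inverse (real (Suc k)))"
    by (auto simp: subset_eq simp del: of_nat_Suc)
  have fm [measurable]: "f \<in> borel_measurable lebesgue"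
    by (rule measurable_funs_trunc_metric(1)[OF besicovitch_apD(1)[OF f]])
  have "lipschitz_approximable f {t. dist (f t) x < r}"
    unfolding lipschitz_approximable_def
  proof (intro conjI allI impI)
    have "f -` {u. dist u x < r} \<inter> space lebesgue \<in> sets lebesgue"
      using fm by (rule measurable_sets) (intro borel_open open_Collect_less continuous_intros)
    then show "{t. dist (f t) x < r} \<in> sets lebesgue"
      by (simp add: vimage_def)
    fix \<eta> :: real
    assume "0 < \<eta>"
    then obtain k where k: "inverse (real (Suc k)) < \<eta>"
      using reals_Archimedean by blast
    obtain \<delta> where \<delta>: "0 < \<delta>" "\<delta> \<le> 1"
        "upper_mean (\<lambda>t. spike x \<delta> r (f t)) < ennreal (inverse (real (Suc k)) * \<delta>)"
      using r(3)[of k] unfolding B_def by (auto simp: not_le simp del: of_nat_Suc)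
    \<comment> \<open>The ramp climbs from 0 on the sphere to 1 at depth \<delta> inside. In
      between, its distance to the indicator is exactly
      \<open>spike x \<delta> r u / \<delta>\<close>; elsewhere the two agree.\<close>
    define \<Phi> where "\<Phi> u = min 1 (max 0 ((r - dist u x) / \<delta>))" for u
    have "(1 / \<delta>)-lipschitz_on UNIV \<Phi>"
    proof (rule lipschitz_onI)
      fix u v
      have "\<bar>\<Phi> u - \<Phi> v\<bar> \<le> \<bar>(r - dist u x) / \<delta> - (r - dist v x) / \<delta>\<bar>"
        unfolding \<Phi>_def by linarith
      also have "\<dots> = \<bar>dist u x - dist v x\<bar> / \<delta>"
        using \<delta>(1) by (simp add: abs_minus_commute flip: diff_divide_distrib)
      also have "\<dots> \<le> dist u v / \<delta>"
        using \<delta>(1) abs_dist_diff_le[of u x v] by (intro divide_right_mono) (auto simp: dist_commute)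
      finally show "dist (\<Phi> u) (\<Phi> v) \<le> 1 / \<delta> * dist u v"
        by (simp add: dist_real_def)
    qed (use \<delta> in auto)
    moreover have "range \<Phi> \<subseteq> {0..1}"
      by (auto simp: \<Phi>_def)
    moreover have "upper_mean (\<lambda>t. \<bar>indicator {t. dist (f t) x < r} t - \<Phi> (f t)\<bar>) \<le> ennreal \<eta>"
    proof -
      note [measurable] = lipschitz_on_UNIV_measurable[OF spike_lipschitz]
      have "upper_mean (\<lambda>t. \<bar>indicator {t. dist (f t) x < r} t - \<Phi> (f t)\<bar>) \<le>
          upper_mean (\<lambda>t. (1 / \<delta>) * spike x \<delta> r (f t))"
        using \<delta>(1)
        by (intro upper_mean_mono) (auto simp: indicator_def \<Phi>_def spike_def field_simps max_def min_def abs_if)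
      also have "\<dots> = ennreal (1 / \<delta>) * upper_mean (\<lambda>t. spike x \<delta> r (f t))"
        by (rule upper_mean_cmult) (use \<delta> in auto)
      also have "\<dots> \<le> ennreal (1 / \<delta>) * ennreal (inverse (real (Suc k)) * \<delta>)"
        using \<delta>(3) by (intro mult_left_mono) auto
      also have "\<dots> = ennreal (inverse (real (Suc k)))"
        using \<delta>(1) by (simp flip: ennreal_mult del: of_nat_Suc)
      also have "\<dots> \<le> ennreal \<eta>"
        using k by (intro ennreal_leI) auto
      finally show ?thesis .
    qed
    ultimately show "\<exists>L \<Psi>. L-lipschitz_on UNIV \<Psi> \<and> range \<Psi> \<subseteq> {0..1} \<and>
        upper_mean (\<lambda>t. \<bar>indicator {t. dist (f t) x < r} t - \<Psi> (f t)\<bar>) \<le> ennreal \<eta>"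
      by blast
  qed
  with r show thesis
    by (intro that)
qed

section \<open>Finite nets in upper mean\<close>

lemma infdist_unit_lipschitz: "1-lipschitz_on UNIV (\<lambda>u. min 1 (infdist u F))"
proof (rule lipschitz_onI)
  fix u v :: 'a
  have "\<bar>infdist u F - infdist v F\<bar> \<le> dist u v"
    by (rule infdist_triangle_abs)
  then show "dist (min 1 (infdist u F)) (min 1 (infdist v F)) \<le> 1 * dist u v"
    unfolding dist_real_def by linarith
qed simp

text \<open>Almost all values of \<open>g\<close> lie in the closure of a countable set, so the
  distance to its first points tends to 0 a.e. Dominated convergence on the single window makes the
  integral small, and the window estimate carries this over to \<open>f\<close> on the whole
  line.\<close>

lemma besicovitch_ap_finite_net:
  fixes f :: "real \<Rightarrow> 'a::metric_space"
  assumes f: "f \<in> besicovitch_ap dist x0" and \<eta>: "0 < \<eta>"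
  shows "\<exists>F. finite F \<and> F \<noteq> {} \<and> upper_mean (\<lambda>t. min 1 (infdist (f t) F)) \<le> ennreal \<eta>"
proof -
  have "0 < \<eta> / 2"
    using \<eta> by simp
  from besicovitch_ap_upper_mean_le[OF f this]
  obtain g and n :: nat where g: "g \<in> stepanov_ap (trunc_metric dist) x0 1" and n: "0 < n" and
    le: "\<And>\<Psi>. 1-lipschitz_on UNIV \<Psi> \<Longrightarrow> range \<Psi> \<subseteq> {0..1::real} \<Longrightarrow>
      upper_mean (\<lambda>t. \<Psi> (f t)) \<le>
        (\<integral>\<^sup>+ t\<in>{0..2 * real n}. ennreal (\<Psi> (g t)) \<partial>lebesgue) / of_nat n + ennreal (\<eta> / 2)"
    by blast
  note [measurable] = measurable_funs_trunc_metric(1)[OF stepanov_apD(1)[OF g]]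
    lipschitz_on_UNIV_measurable[OF infdist_unit_lipschitz]
  obtain C0 where C0: "countable C0" "AE t in lebesgue. g t \<in> closure C0"
    using measurable_funs_trunc_metric(2)[OF stepanov_apD(1)[OF g]] by blast
  \<comment> \<open>Inserting \<open>x0\<close> makes the enumerated set nonempty.\<close>
  define c where "c = from_nat_into (insert x0 C0)"
  have c: "range c = insert x0 C0"
    unfolding c_def using C0(1) by (intro range_from_nat_into) auto
  define h where "h m t = ennreal (min 1 (infdist (g t) (c ` {..m}))) * indicator {0..2 * real n} t" for m t
  have [measurable]: "h m \<in> borel_measurable lebesgue" for m
    unfolding h_def by measurable
  have "(\<lambda>m. \<integral>\<^sup>+ t. h m t \<partial>lebesgue) \<longlonglongrightarrow> (\<integral>\<^sup>+ t. 0 \<partial>(lebesgue :: real measure))"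
  proof (rule nn_integral_dominated_convergence)
    show "(\<integral>\<^sup>+ t. indicator {0..2 * real n} t \<partial>lebesgue) < \<infinity>"
      by simp
    show "AE t in lebesgue. h m t \<le> indicator {0..2 * real n} t" for m
      by (auto simp: h_def indicator_def)
    show "AE t in lebesgue. (\<lambda>m. h m t) \<longlonglongrightarrow> 0"
      using C0(2)
    proof eventually_elim
      case (elim t)
      show ?case
        unfolding tendsto_0_ennreal_iff
      proof safe
        fix e :: real
        assume "0 < e"
        then obtain y where y: "y \<in> C0" "dist y (g t) < e"
          using elim by (auto simp: closure_approachable)
        obtain m0 where m0: "y = c m0"
          using c y(1) by (metis insertI2 imageE)
        have "h m t \<le> ennreal e" if "m0 \<le> m" for m
        proof -
          have "infdist (g t) (c ` {..m}) \<le> dist (g t) y"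
            using that m0 by (intro infdist_le) auto
          then show ?thesis
            using y(2) by (auto simp: h_def indicator_def dist_commute intro!: ennreal_leI)
        qed
        then show "\<forall>\<^sub>F m in sequentially. h m t \<le> ennreal e"
          by (auto simp: eventually_sequentially)
      qed
    qed
  qed measurable
  then have "(\<lambda>m. \<integral>\<^sup>+ t. h m t \<partial>lebesgue) \<longlonglongrightarrow> 0"
    by simp
  \<comment> \<open>The window estimate divides by \<open>n\<close>, which leaves
    \<open>\<eta> / 2\<close> of this threshold.\<close>
  moreover have "0 < real n * \<eta> / 2"
    using n \<eta> by simp
  ultimately have "\<forall>\<^sub>F m in sequentially. (\<integral>\<^sup>+ t. h m t \<partial>lebesgue) \<le> ennreal (real n * \<eta> / 2)"
    unfolding tendsto_0_ennreal_iff by blast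
  then obtain m where m: "(\<integral>\<^sup>+ t. h m t \<partial>lebesgue) \<le> ennreal (real n * \<eta> / 2)"
    by (auto simp: eventually_sequentially)
  have "upper_mean (\<lambda>t. min 1 (infdist (f t) (c ` {..m}))) \<le> (\<integral>\<^sup>+ t. h m t \<partial>lebesgue) / of_nat n + ennreal (\<eta> / 2)"
    unfolding h_def by (intro le infdist_unit_lipschitz) (auto simp: infdist_nonneg)
  also have "\<dots> \<le> ennreal (real n * \<eta> / 2) / ennreal (real n) + ennreal (\<eta> / 2)"
    using m unfolding ennreal_of_nat_eq_real_of_nat by (intro add_right_mono divide_right_mono_ennreal)
  also have "\<dots> = ennreal \<eta>"
    using n \<eta> by (simp add: divide_ennreal flip: ennreal_plus)
  finally show ?thesis
    by (intro exI[of _ "c ` {..m}"]) auto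
qed

section \<open>Codensities and the final partition\<close>

lemma upper_codensity_eq_upper_mean:
  assumes "T \<in> sets lebesgue"
  shows "upper_codensity T = upper_mean (indicator (- T))"
proof -
  have "emeasure lebesgue ({- b..b} - T) = (\<integral>\<^sup>+ t\<in>{- b..b}. ennreal (indicator (- T) t) \<partial>lebesgue)" for b
  proof -
    have "emeasure lebesgue ({- b..b} - T) = (\<integral>\<^sup>+ t. indicator ({- b..b} - T) t \<partial>lebesgue)"
      using assms by (intro nn_integral_indicator[symmetric]) auto
    also have "\<dots> = (\<integral>\<^sup>+ t\<in>{- b..b}. ennreal (indicator (- T) t) \<partial>lebesgue)"
      by (intro nn_integral_cong) (auto simp: indicator_def)
    finally show ?thesis .
  qed
  then show ?thesis
    by (simp add: upper_codensity_def upper_mean_def)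
qed

theorem theorem2p1:
  fixes f :: "real \<Rightarrow> 'a::complete_space" and x0 :: 'a and \<epsilon> :: real
  assumes "f \<in> besicovitch_ap dist x0" and "\<epsilon> > 0"
  shows "\<exists>T \<in> besicovitch_partitions (Mod_fun dist f). \<exists>x :: nat \<Rightarrow> 'a.
           \<forall>j. \<forall>t \<in> T j. dist (f t) (x j) < \<epsilon>"
proof -
  note f = assms(1)
  have fm: "f \<in> borel_measurable lebesgue"
    by (rule measurable_funs_trunc_metric(1)[OF besicovitch_apD(1)[OF f]])
  \<comment> \<open>The cap at 1 lets the lower bound \<open>\<rho> / 2\<close> for distances
    survive in \<open>min 1 (infdist u (F k))\<close>.\<close>
  define \<rho> where "\<rho> = min \<epsilon> 1"
  have \<rho>: "0 < \<rho>" "\<rho> \<le> 1" "\<rho> \<le> \<epsilon>"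
    using assms(2) by (auto simp: \<rho>_def)
  obtain C0 where C0: "countable C0" "AE t in lebesgue. f t \<in> closure C0"
    using measurable_funs_trunc_metric(2)[OF besicovitch_apD(1)[OF f]] by blast
  have "\<exists>F. finite F \<and> F \<noteq> {} \<and> upper_mean (\<lambda>t. min 1 (infdist (f t) F)) \<le> ennreal (inverse (real (Suc k)))" for k
    by (intro besicovitch_ap_finite_net[OF f]) simp
  then obtain F where F: "\<And>k. finite (F k)" "\<And>k. F k \<noteq> {}"
    "\<And>k. upper_mean (\<lambda>t. min 1 (infdist (f t) (F k))) \<le> ennreal (inverse (real (Suc k)))"
    by metis
  \<comment> \<open>As centres, the points of \<open>C0\<close> make the balls cover almost every
    \<open>f t\<close>, the nets \<open>F k\<close> control the codensities, and \<open>x0\<close>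
    keeps the set nonempty.\<close>
  define C where "C = insert x0 (C0 \<union> (\<Union>k. F k))"
  have "countable C"
    using C0(1) F(1) by (auto simp: C_def countable_finite)
  then have x: "range (from_nat_into C) = C"
    by (intro range_from_nat_into) (auto simp: C_def)
  define x where "x = from_nat_into C"
  \<comment> \<open>The common lower bound \<open>\<rho> / 2\<close> lets every ball catch all
    points within \<open>\<rho> / 2\<close> of its centre, however the radii vary.\<close>
  have "\<exists>r. \<rho> / 2 < r \<and> r < \<rho> \<and> lipschitz_approximable f {t. dist (f t) (x j) < r}" for j
    by (rule exists_approximable_radius[OF f, of "\<rho> / 2" \<rho> "x j"]) (use \<rho> in auto)
  then obtain r where r: "\<And>j. \<rho> / 2 < r j" "\<And>j. r j < \<rho>"
    "\<And>j. lipschitz_approximable f {t. dist (f t) (x j) < r j}"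
    by metis
  define A where "A j = {t. dist (f t) (x j) < r j}" for j
  define T where "T = disjointed A"
  have A: "lipschitz_approximable f (A j)" for j
    using r(3) by (simp add: A_def)
  have T: "lipschitz_approximable f (T j)" for j
    unfolding T_def by (intro lipschitz_approximable_disjointed fm A)
  have sets: "A j \<in> sets lebesgue" for j
    using A by (auto simp: lipschitz_approximable_def)
  have "emeasure lebesgue (UNIV - (\<Union>j. T j)) = 0"
  proof -
    have "AE t in lebesgue. t \<notin> UNIV - (\<Union>j. A j)"
      using C0(2)
    proof eventually_elim
      case (elim t)
      then obtain y where y: "y \<in> C0" "dist y (f t) < \<rho> / 2"
        using \<rho>(1) by (auto simp: closure_approachable dest: spec[of _ "\<rho> / 2"])
      obtain j where "y = x j"
        using y(1) x by (metis C_def UnI1 imageE insertI2 x_def)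
      then have "t \<in> A j"
        using y(2) r(1)[of j] by (simp add: A_def dist_commute)
      then show ?case
        by blast
    qed
    then show ?thesis
      using sets unfolding T_def UN_disjointed_eq
      by (subst (asm) AE_iff_null_sets[symmetric]) (auto simp: null_sets_def Compl_eq_Diff_UNIV[symmetric] Compl_in_sets_lebesgue)
  qed
  moreover have "(\<lambda>n. upper_codensity (\<Union>j\<le>n. T j)) \<longlonglongrightarrow> 0"
    unfolding tendsto_0_ennreal_iff
  proof safe
    fix e :: real
    assume e: "0 < e"
    then obtain k where k: "inverse (real (Suc k)) < e * \<rho> / 2"
      using reals_Archimedean[of "e * \<rho> / 2"] \<rho>(1) by auto
    have "F k \<subseteq> range x"
      using x by (auto simp: C_def x_def)
    then obtain J where J: "finite J" "F k = x ` J"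
      using F(1) finite_subset_image[of "F k" x UNIV] by blast
    \<comment> \<open>From \<open>n0\<close> on, every point of the net \<open>F k\<close> is the
      centre of one of the balls used.\<close>
    obtain n0 where n0: "J \<subseteq> {..n0}"
      using J(1) finite_nat_iff_bounded_le by blast
    have "upper_codensity (\<Union>j\<le>n. T j) \<le> ennreal e" if "n0 \<le> n" for n
    proof -
      have T_eq: "(\<Union>j\<le>n. T j) = (\<Union>j\<le>n. A j)"
        using finite_UN_disjointed_eq[of A "Suc n"]
        by (simp add: T_def atLeast0LessThan lessThan_Suc_atMost)
      let ?\<Psi> = "\<lambda>u. min 1 (infdist u (F k))"
      \<comment> \<open>Markov's inequality in pointwise form: outside the first balls,
        \<open>f t\<close> is at least \<open>\<rho> / 2\<close> away from the net.\<close>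
      have ind: "indicator (- (\<Union>j\<le>n. A j)) t \<le> (2 / \<rho>) * ?\<Psi> (f t)" for t
      proof (cases "t \<in> (\<Union>j\<le>n. A j)")
        case False
        have "\<rho> / 2 \<le> infdist (f t) (F k)"
          unfolding infdist_notempty[OF F(2)]
        proof (rule cINF_greatest[OF F(2)])
          fix y
          assume "y \<in> F k"
          then obtain j where j: "j \<in> J" "y = x j"
            using J(2) by blast
          then have "t \<notin> A j"
            using False n0 that by auto
          then show "\<rho> / 2 \<le> dist (f t) y"
            using r(1)[of j] j(2) by (simp add: A_def)
        qed
        then have "\<rho> / 2 \<le> ?\<Psi> (f t)"
          using \<rho> by simp
        then have "(2 / \<rho>) * (\<rho> / 2) \<le> (2 / \<rho>) * ?\<Psi> (f t)"
          using \<rho>(1) by (intro mult_left_mono) auto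
        then show ?thesis
          using \<rho>(1) False by simp
      next
        case True
        then show ?thesis
          using \<rho>(1) infdist_nonneg[of "f t" "F k"] by (subst indicator_simps(2)) auto
      qed
      note [measurable] = fm lipschitz_on_UNIV_measurable[OF infdist_unit_lipschitz]
      have "upper_codensity (\<Union>j\<le>n. T j) = upper_mean (indicator (- (\<Union>j\<le>n. A j)))"
        unfolding T_eq using sets by (intro upper_codensity_eq_upper_mean) auto
      also have "\<dots> \<le> upper_mean (\<lambda>t. (2 / \<rho>) * ?\<Psi> (f t))"
        by (rule upper_mean_mono[OF ind])
      also have "\<dots> = ennreal (2 / \<rho>) * upper_mean (\<lambda>t. ?\<Psi> (f t))"
        by (rule upper_mean_cmult) (measurable, use \<rho> in auto)
      also have "\<dots> \<le> ennreal (2 / \<rho>) * ennreal (e * \<rho> / 2)"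
        using k by (intro mult_left_mono order_trans[OF F(3)] ennreal_leI) auto
      also have "\<dots> = ennreal e"
        using \<rho>(1) e by (simp flip: ennreal_mult)
      finally show ?thesis .
    qed
    then show "\<forall>\<^sub>F n in sequentially. upper_codensity (\<Union>j\<le>n. T j) \<le> ennreal e"
      by (auto simp: eventually_sequentially)
  qed
  ultimately have "T \<in> besicovitch_partitions (Mod_fun dist f)"
    using T lipschitz_approximable_besicovitch_sets[OF f] lipschitz_approximable_Mod_set[OF fm]
    unfolding besicovitch_partitions_def by (auto simp: T_def disjoint_family_disjointed)
  moreover have "dist (f t) (x j) < \<epsilon>" if "t \<in> T j" for t j
  proof -
    have "t \<in> A j"
      using that disjointed_subset[of A j] by (auto simp: T_def)
    then show ?thesis
      using r(2)[of j] \<rho>(3) by (simp add: A_def)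
  qed
  ultimately show ?thesis
    by blast
qed

end
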